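(* Let $\{\widetilde{\mathbf p}_n\}_{n=0}^\infty$ be an arbitrary sequence where $\widetilde{\mathbf p}_n\in\mathrm{Sym}(W^{\mathrm{gr}})^{r_n}$ is a column vector of length $r_n$, and $\widetilde{\mathbf p}_0=1$. Then the following are equivalent. (1) There exists a positive-definite linear functional $\mathcal L$ on $\mathrm{Sym}(W^{\mathrm{gr}})$ under which $\{\widetilde{\mathbf p}_n\}_{n=0}^\infty$ is an orthonormal basis of $\mathrm{Sym}(W^{\mathrm{gr}})$. (2) For $n\in\mathbb N_0$, $m\in[n]$, $i\in[N_m]$ and $0\le k\le m$, there exist matrices $M^k_{n,m,i}\in\mathrm{Mat}(r_{n-m},r_{n-m+k})$ such that (a) for all such $n,m,i$, $$w_{m,i}\,\widetilde{\mathbf p}_{n-m}=\sum_{k=0}^{m}M^k_{n,m,i}\,\widetilde{\mathbf p}_{n-m+k}+\sum_{k=1}^{m}(M^k_{n-k,m,i})^{\intercal}\,\widetilde{\mathbf p}_{n-m-k};$$ (b) the matrices $A_{n,m,i}:=M^m_{n,m,i}\in\mathrm{Mat}(r_{n-m},r_n)$ and $C_{n,m,i}:=(M^m_{n,m,i})^{\intercal}\in\mathrm{Mat}(r_n,r_{n-m})$ satisfy, for every $n\in\mathbb N$, $m\in[n]$, $i\in[N_m]$, $$\mathrm{rank}(A_{n,m,i})=\mathrm{rank}(C_{n,m,i})=r_{n-m}\quad\text{and}\quad \mathrm{rank}(A_n)=\mathrm{rank}(C_n^{\intercal})=r_n,$$ where $A_n$ (resp. $C_n^{\intercal}$) is the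 matrix with $r_n$ columns obtained by stacking vertically all $A_{n,m,i}$ (resp. all $C_{n,m,i}^{\intercal}$), $m\in[n]$, $i\in[N_m]$.
   Context: $W=\bigoplus_{m\ge1}W^m$ is a graded real vector space with every $W^m$ finite-dimensional, $N_m=\dim W^m$; $W^{\mathrm{gr}}=\bigoplus_m (W^m)^*$ is the graded dual, and $w_{m,1},\dots,w_{m,N_m}$ is a fixed basis of $(W^m)^*$. $\mathrm{Sym}(W^{\mathrm{gr}})$ is the symmetric algebra, i.e. the commutative real polynomial algebra in the indeterminates $w_{m,i}$. The total degree of a monomial $\prod w_{m,i}^{\alpha_{m,i}}$ is $\sum m\,\alpha_{m,i}$. $r_n$ is the number of monomials of total degree $n$ and $\mathbf w_n$ the column vector of these monomials. $[n]=\{1,\dots,n\}$. $\mathrm{Mat}(a,b)$ denotes real $a\times b$ matrices. Terms with negative degree index are absent ($r_j=0$ and $\widetilde{\mathbf p}_j=0$ for $j<0$; in particular the term $(M^k_{n-k,m,i})^{\intercal}\widetilde{\mathbf p}_{n-m-k}$ is omitted when $n-m-k<0$). A linear functional $\mathcal L:\mathrm{Sym}(W^{\mathrm{gr}})\to\mathbb R$ is positive-definite if there is a basis of $\mathrm{Sym}(W^{\mathrm{gr}})$ such that for basis elements $P,Q$: $\mathcal L(PQ)=0$ if $P\ne Q$ and $\mathcal L(P^2)>0$. Write $(P,Q)=\mathcal L(PQ)$; for column vectors $\mathbf p,\mathbf q$ of polynomials, $(\mathbf p,\mathbf q^{\intercal})$ is the matrix of entrywise values. A sequence $\{\widetilde{\mathbf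 p}_n\}$, with $\widetilde{\mathbf p}_n$ a column vector of length $r_n$ with entries of total degree at most $n$, is orthonormal (under $\mathcal L$) if $(\mathbf w_m,\widetilde{\mathbf p}_n^{\intercal})=0$ for all $m<n$, $(\mathbf w_n,\widetilde{\mathbf p}_n^{\intercal})$ is invertible, and $(\widetilde{\mathbf p}_n,\widetilde{\mathbf p}_n^{\intercal})$ is the identity matrix. *)

theory Defs
  imports
    "HOL-Analysis.Finite_Function_Topology"
    "Jordan_Normal_Form.DL_Rank"
begin

text \<open>
  The indeterminate \<open>w\<^sub>m\<^sub>,\<^sub>i\<close> is the index pair \<open>(m, i)\<close>. The graded space enters only through its
  dimensions \<open>N m\<close>, so the symmetric algebra of the graded dual is the subalgebra \<open>Sym N\<close> of the
  polynomials over all pairs in which only pairs with \<open>m \<ge> 1\<close> and \<open>1 \<le> i \<le> N m\<close> occur.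
  The real vector space structure on \<open>\<Rightarrow>\<^sub>0\<close> is that of \<open>Finite_Function_Topology\<close>; only its scalar
  multiplication is used, not its norm.
\<close>

type_synonym gmonom = "(nat \<times> nat) \<Rightarrow>\<^sub>0 nat"
type_synonym gpoly = "gmonom \<Rightarrow>\<^sub>0 real"

definition monoms :: "(nat \<Rightarrow> nat) \<Rightarrow> gmonom set" where
  "monoms N = {\<alpha>. Poly_Mapping.keys \<alpha> \<subseteq> {(m, i). 1 \<le> m \<and> i \<in> {1..N m}}}"

definition Sym :: "(nat \<Rightarrow> nat) \<Rightarrow> gpoly set" where
  "Sym N = {P. Poly_Mapping.keys P \<subseteq> monoms N}"

definition indet :: "nat \<Rightarrow> nat \<Rightarrow> gpoly" where
  "indet m i = Poly_Mapping.single (Poly_Mapping.single (m, i) 1) 1"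

definition mdeg :: "gmonom \<Rightarrow> nat" where
  "mdeg \<alpha> = (\<Sum>(m, i)\<in>Poly_Mapping.keys \<alpha>. m * Poly_Mapping.lookup \<alpha> (m, i))"

definition total_degree_le :: "gpoly \<Rightarrow> nat \<Rightarrow> bool" where
  "total_degree_le P n \<longleftrightarrow> (\<forall>\<alpha>\<in>Poly_Mapping.keys P. mdeg \<alpha> \<le> n)"

definition monoms_of_degree :: "(nat \<Rightarrow> nat) \<Rightarrow> nat \<Rightarrow> gmonom set" where
  "monoms_of_degree N n = {\<alpha> \<in> monoms N. mdeg \<alpha> = n}"

definition r :: "(nat \<Rightarrow> nat) \<Rightarrow> nat \<Rightarrow> nat" where
  "r N n = card (monoms_of_degree N n)"

text \<open>The monomials of degree \<open>n\<close> as a column vector, in an unspecified order.\<close>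

definition is_monom_vec :: "(nat \<Rightarrow> nat) \<Rightarrow> nat \<Rightarrow> gpoly vec \<Rightarrow> bool" where
  "is_monom_vec N n v \<longleftrightarrow>
     (\<exists>\<alpha>s. distinct \<alpha>s \<and> set \<alpha>s = monoms_of_degree N n \<and>
           v = vec_of_list (map (\<lambda>\<alpha>. Poly_Mapping.single \<alpha> 1) \<alpha>s))"

definition is_basis_Sym :: "(nat \<Rightarrow> nat) \<Rightarrow> gpoly set \<Rightarrow> bool" where
  "is_basis_Sym N B \<longleftrightarrow> B \<subseteq> Sym N \<and> \<not> Real_Vector_Spaces.dependent B \<and> Real_Vector_Spaces.span B = Sym N"

text \<open>A functional on \<open>Sym N\<close> is given by a function on the ambient type whose values outside
  \<open>Sym N\<close> are irrelevant.\<close>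

definition linear_functional :: "(nat \<Rightarrow> nat) \<Rightarrow> (gpoly \<Rightarrow> real) \<Rightarrow> bool" where
  "linear_functional N L \<longleftrightarrow>
     (\<forall>P\<in>Sym N. \<forall>Q\<in>Sym N. L (P + Q) = L P + L Q) \<and>
     (\<forall>c. \<forall>P\<in>Sym N. L (c *\<^sub>R P) = c * L P)"

definition positive_definite :: "(nat \<Rightarrow> nat) \<Rightarrow> (gpoly \<Rightarrow> real) \<Rightarrow> bool" where
  "positive_definite N L \<longleftrightarrow> linear_functional N L \<and>
     (\<exists>B. is_basis_Sym N B \<and>
        (\<forall>P\<in>B. \<forall>Q\<in>B. P \<noteq> Q \<longrightarrow> L (P * Q) = 0) \<and>
        (\<forall>P\<in>B. L (P * P) > 0))"

text \<open>\<open>pairing L u v\<close> is the matrix \<open>(u, v\<^sup>T)\<close> with entries \<open>L (u\<^sub>a v\<^sub>b)\<close>.\<close>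

definition pairing :: "(gpoly \<Rightarrow> real) \<Rightarrow> gpoly vec \<Rightarrow> gpoly vec \<Rightarrow> real mat" where
  "pairing L u v = mat (dim_vec u) (dim_vec v) (\<lambda>(a, b). L (u $ a * v $ b))"

definition orthonormal ::
  "(nat \<Rightarrow> nat) \<Rightarrow> (nat \<Rightarrow> gpoly vec) \<Rightarrow> (gpoly \<Rightarrow> real) \<Rightarrow> (nat \<Rightarrow> gpoly vec) \<Rightarrow> bool" where
  "orthonormal N w L p \<longleftrightarrow>
     (\<forall>n. p n \<in> carrier_vec (r N n) \<and>
          (\<forall>P\<in>set\<^sub>v (p n). P \<in> Sym N \<and> total_degree_le P n) \<and>
          (\<forall>m<n. pairing L (w m) (p n) = 0\<^sub>m (r N m) (r N n)) \<and>
          invertible_mat (pairing L (w n) (p n)) \<and>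
          pairing L (p n) (p n) = 1\<^sub>m (r N n))"

text \<open>The entries of all \<open>p n\<close>, as a family indexed by position, form a basis.\<close>

definition entries_form_basis :: "(nat \<Rightarrow> nat) \<Rightarrow> (nat \<Rightarrow> gpoly vec) \<Rightarrow> bool" where
  "entries_form_basis N p \<longleftrightarrow>
     inj_on (\<lambda>(n, j). p n $ j) {(n, j). j < dim_vec (p n)} \<and>
     is_basis_Sym N ((\<lambda>(n, j). p n $ j) ` {(n, j). j < dim_vec (p n)})"

text \<open>A real matrix acts on a vector of polynomials through the constant polynomials.\<close>

definition mat_act :: "real mat \<Rightarrow> gpoly vec \<Rightarrow> gpoly vec" where
  "mat_act A v = map_mat (\<lambda>c. Poly_Mapping.single 0 c) A *\<^sub>v v"

text \<open>\<open>vec_space.rank\<close> takes the dimension of the ambient column space as its first argument.\<close>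

definition mat_rank :: "real mat \<Rightarrow> nat" where
  "mat_rank A = vec_space.rank (dim_row A) A"

definition stack :: "nat \<Rightarrow> real mat list \<Rightarrow> real mat" where
  "stack nc As = foldr append_rows As (0\<^sub>m 0 nc)"

definition index_pairs :: "(nat \<Rightarrow> nat) \<Rightarrow> nat \<Rightarrow> (nat \<times> nat) list" where
  "index_pairs N n = [(m, i). m \<leftarrow> [1..<Suc n], i \<leftarrow> [1..<Suc (N m)]]"

lemma set_index_pairs: "set (index_pairs N n) = {(m, i). m \<in> {1..n} \<and> i \<in> {1..N m}}"
  by (auto simp: index_pairs_def image_iff simp del: upt_Suc)

lemma finite_monoms_of_degree: "finite (monoms_of_degree N n)"
proof -
  let ?X = "SIGMA m:{1..n}. {1..N m}"
  let ?F = "{f. \<forall>x. (x \<in> ?X \<longrightarrow> f x \<in> {0..n}) \<and> (x \<notin> ?X \<longrightarrow> f x = (0::nat))}"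
  have "finite ?F" by (rule finite_set_of_finite_funs) auto
  moreover have "Poly_Mapping.lookup ` monoms_of_degree N n \<subseteq> ?F"
  proof (rule image_subsetI)
    fix \<alpha> assume a: "\<alpha> \<in> monoms_of_degree N n"
    have le: "m * Poly_Mapping.lookup \<alpha> (m, i) \<le> n" if "(m, i) \<in> Poly_Mapping.keys \<alpha>" for m i
      using member_le_sum[OF that, of "\<lambda>(m, i). m * Poly_Mapping.lookup \<alpha> (m, i)"] a
      by (simp add: monoms_of_degree_def mdeg_def)
    have k: "(m, i) \<in> ?X \<and> Poly_Mapping.lookup \<alpha> (m, i) \<le> n"
      if "(m, i) \<in> Poly_Mapping.keys \<alpha>" for m i
    proof -
      have mi: "1 \<le> m" "i \<in> {1..N m}"
        using a that by (auto simp: monoms_of_degree_def monoms_def)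
      have l: "1 \<le> Poly_Mapping.lookup \<alpha> (m, i)"
        using that by (simp add: in_keys_iff Suc_le_eq)
      have "m * 1 \<le> n" using le[OF that] mult_le_mono2[OF l, of m] by linarith
      moreover have "1 * Poly_Mapping.lookup \<alpha> (m, i) \<le> n"
        using le[OF that] mult_le_mono1[OF mi(1)] by (rule order_trans[rotated])
      ultimately show ?thesis using mi by auto
    qed
    have "Poly_Mapping.lookup \<alpha> x \<le> n" for x
      using k[of "fst x" "snd x"] by (cases "x \<in> Poly_Mapping.keys \<alpha>") (auto simp: in_keys_iff)
    moreover have "Poly_Mapping.lookup \<alpha> x = 0" if "x \<notin> ?X" for x
      using k[of "fst x" "snd x"] that by (auto simp: in_keys_iff)
    ultimately show "Poly_Mapping.lookup \<alpha> \<in> ?F" by auto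
  qed
  ultimately have "finite (Poly_Mapping.lookup ` monoms_of_degree N n)"
    by (rule rev_finite_subset)
  then show ?thesis
    by (rule finite_imageD) (auto simp: inj_on_def intro: poly_mapping_eqI)
qed

end

theory Submission
  imports Defs
begin

text \<open>
  Suppose that the sequence is orthonormal for \<open>L\<close>. Its entries form an orthonormal basis, and those of
  \<open>p\<^sub>n\<close> are orthogonal to all polynomials of degree less than \<open>n\<close>. Hence every \<open>P\<close> of degree at most \<open>n\<close>
  equals its Fourier expansion in the entries of \<open>p\<^sub>0, \<dots>, p\<^sub>n\<close> (lemma \<open>Fourier_expansion\<close>). For
  \<open>P = w\<^sub>m\<^sub>,\<^sub>i p\<^sub>n\<^sub>-\<^sub>m\<close> the Fourier coefficients are the entries of the matrices
  \<open>(w\<^sub>m\<^sub>,\<^sub>i p\<^sub>n\<^sub>-\<^sub>m, p\<^sub>b\<^sup>T)\<close>. Because \<open>L ((w P) Q) = L ((w Q) P)\<close>, those with \<open>b < n - m\<close> are transposes of matrices of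
  the same kind, and vanish if \<open>b < n - 2 m\<close>; this is the recurrence. The rank conditions follow by looking
  at kernels: a relation between the rows of \<open>A\<^sub>n\<^sub>,\<^sub>m\<^sub>,\<^sub>i\<close> would produce a combination of the entries of
  \<open>p\<^sub>n\<^sub>-\<^sub>m\<close> of degree less than \<open>n - m\<close>, and a vector killed by all \<open>A\<^sub>n\<^sub>,\<^sub>m\<^sub>,\<^sub>i\<close> would produce a combination of
  the entries of \<open>p\<^sub>n\<close> that is orthogonal to every monomial of degree \<open>n\<close>.

  Conversely, suppose that the recurrence holds. Starting from \<open>p\<^sub>0 = 1\<close>, it shows that every monomial of degree at
  most \<open>n\<close> lies in the span of the entries of \<open>p\<^sub>0, \<dots>, p\<^sub>n\<close>. There are \<open>r\<^sub>0 + \<dots> + r\<^sub>n\<close> of both, so these entries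
  form a basis of the polynomials of degree at most \<open>n\<close>. Let \<open>\<phi>\<^sub>n\<^sub>,\<^sub>j\<close> be the coordinate functionals of the basis
  of all entries, and let \<open>L = \<phi>\<^sub>0\<^sub>,\<^sub>0\<close>. Multiplication by \<open>w\<^sub>m\<^sub>,\<^sub>i\<close> changes the index of \<open>p\<^sub>b\<close> by at most \<open>m\<close>, so
  \<open>L (P p\<^sub>n\<^sub>,\<^sub>j) = 0\<close> whenever \<open>P\<close> has degree less than \<open>n\<close>. The decisive identity is
  \<open>L (P p\<^sub>n\<^sub>,\<^sub>j) = \<phi>\<^sub>n\<^sub>,\<^sub>j P\<close> for all \<open>P\<close> of degree at most \<open>n\<close> (lemma \<open>L_coordinate\<close>), by induction on the
  degree: both sides turn a factor \<open>w\<^sub>m\<^sub>,\<^sub>i\<close> into the matrix \<open>A\<^sub>n\<^sub>,\<^sub>m\<^sub>,\<^sub>i\<close>, the left side because the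
  recurrence couples \<open>p\<^sub>n\<close> to \<open>p\<^sub>n\<^sub>-\<^sub>m\<close> by its transpose. With \<open>P = p\<^sub>n\<^sub>,\<^sub>l\<close> it says that the entries
  are orthonormal.
\<close>

section \<open>Polynomials with prescribed support\<close>

text \<open>The monomial with exponent \<open>\<alpha>\<close>, regarded as a polynomial.\<close>

abbreviation monom_of :: "gmonom \<Rightarrow> gpoly" where
  "monom_of \<alpha> \<equiv> Poly_Mapping.single \<alpha> 1"

text \<open>The polynomials of total degree at most \<open>n\<close>, a finite-dimensional subspace of \<open>Sym N\<close>.\<close>

definition Sym_le :: "(nat \<Rightarrow> nat) \<Rightarrow> nat \<Rightarrow> gpoly set" where
  "Sym_le N n = {P \<in> Sym N. total_degree_le P n}"

lemma lookup_scaleR: "Poly_Mapping.lookup (c *\<^sub>R P) \<alpha> = c * Poly_Mapping.lookup (P :: gpoly) \<alpha>"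
proof -
  have "finite {x. c * Poly_Mapping.lookup P x \<noteq> 0}"
    by (rule finite_subset[OF _ finite_keys[of P]]) (auto simp: in_keys_iff)
  then show ?thesis by (simp add: scaleR_poly_mapping_def lookup_Abs_poly_mapping)
qed

lemma scaleR_eq_const_mult: "c *\<^sub>R P = Poly_Mapping.single 0 c * (P :: gpoly)"
proof (rule poly_mapping_eqI)
  show "Poly_Mapping.lookup (c *\<^sub>R P) \<alpha> = Poly_Mapping.lookup (Poly_Mapping.single 0 c * P) \<alpha>" for \<alpha>
    unfolding mult_map_scale_conv_mult[symmetric] lookup_scaleR by transfer (simp add: when_def)
qed

lemma scaleR_mult_gpoly [simp]: "(c *\<^sub>R P) * Q = c *\<^sub>R (P * Q :: gpoly)"
  and mult_scaleR_gpoly [simp]: "P * (c *\<^sub>R Q) = c *\<^sub>R (P * Q :: gpoly)"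
  by (simp_all add: scaleR_eq_const_mult mult_ac)

lemma linear_mult_left: "linear (\<lambda>P. Q * P :: gpoly)"
  by (rule linearI) (simp_all add: distrib_left)

lemma linear_mult_right: "linear (\<lambda>P. P * Q :: gpoly)"
  by (rule linearI) (simp_all add: distrib_right)

lemma subspace_keys: "Real_Vector_Spaces.subspace {P :: gpoly. Poly_Mapping.keys P \<subseteq> S}"
proof (rule real_vector.subspaceI)
  show "x + y \<in> {P. Poly_Mapping.keys P \<subseteq> S}"
    if "x \<in> {P. Poly_Mapping.keys P \<subseteq> S}" "y \<in> {P. Poly_Mapping.keys P \<subseteq> S}" for x y :: gpoly
    using that keys_add[of x y] by auto
qed (auto simp: in_keys_iff lookup_scaleR subset_iff)

lemma monomial_expansion:
  "P = (\<Sum>\<alpha>\<in>Poly_Mapping.keys P. Poly_Mapping.lookup P \<alpha> *\<^sub>R monom_of \<alpha>)"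
proof (rule poly_mapping_eqI)
  fix \<beta>
  have "(\<Sum>\<alpha>\<in>Poly_Mapping.keys P. Poly_Mapping.lookup P \<alpha> * (1 when \<alpha> = \<beta>))
      = (\<Sum>\<alpha>\<in>Poly_Mapping.keys P. if \<alpha> = \<beta> then Poly_Mapping.lookup P \<alpha> else 0)"
    by (rule sum.cong) (auto simp: when_def)
  then show "Poly_Mapping.lookup P \<beta> =
      Poly_Mapping.lookup (\<Sum>\<alpha>\<in>Poly_Mapping.keys P. Poly_Mapping.lookup P \<alpha> *\<^sub>R monom_of \<alpha>) \<beta>"
    by (simp add: lookup_sum lookup_scaleR lookup_single in_keys_iff)
qed

lemma span_monom_of: "Real_Vector_Spaces.span (monom_of ` S) = {P :: gpoly. Poly_Mapping.keys P \<subseteq> S}"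
proof
  show "Real_Vector_Spaces.span (monom_of ` S) \<subseteq> {P. Poly_Mapping.keys P \<subseteq> S}"
    by (rule real_vector.span_minimal[OF _ subspace_keys]) auto
  show "{P. Poly_Mapping.keys P \<subseteq> S} \<subseteq> Real_Vector_Spaces.span (monom_of ` S)"
  proof
    fix P :: gpoly assume "P \<in> {P. Poly_Mapping.keys P \<subseteq> S}"
    then have "(\<Sum>\<alpha>\<in>Poly_Mapping.keys P. Poly_Mapping.lookup P \<alpha> *\<^sub>R monom_of \<alpha>)
        \<in> Real_Vector_Spaces.span (monom_of ` S)"
      by (intro real_vector.span_sum real_vector.span_scale) (auto intro: real_vector.span_base)
    then show "P \<in> Real_Vector_Spaces.span (monom_of ` S)"
      by (simp flip: monomial_expansion)
  qed
qed

lemma monom_of_eq_iff [simp]: "monom_of \<alpha> = monom_of \<beta> \<longleftrightarrow> \<alpha> = \<beta>"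
proof
  assume "monom_of \<alpha> = monom_of \<beta>"
  then have "Poly_Mapping.keys (monom_of \<alpha>) = Poly_Mapping.keys (monom_of \<beta>)" by (rule arg_cong)
  then show "\<alpha> = \<beta>" by simp
qed simp

lemma independent_monom_of: "\<not> Real_Vector_Spaces.dependent (monom_of ` S)"
  unfolding real_vector.dependent_def
proof clarify
  fix \<alpha> assume "monom_of \<alpha> \<in> Real_Vector_Spaces.span (monom_of ` S - {monom_of \<alpha>})"
  also have "monom_of ` S - {monom_of \<alpha>} = monom_of ` (S - {\<alpha>})"
    by auto
  finally show False by (simp add: span_monom_of)
qed

lemma Sym_le_eq: "Sym_le N n = {P. Poly_Mapping.keys P \<subseteq> {\<alpha> \<in> monoms N. mdeg \<alpha> \<le> n}}"
  by (auto simp: Sym_le_def Sym_def total_degree_le_def)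

lemma subspace_Sym_le: "Real_Vector_Spaces.subspace (Sym_le N n)"
  unfolding Sym_le_eq by (rule subspace_keys)

lemma subspace_Sym: "Real_Vector_Spaces.subspace (Sym N)"
  unfolding Sym_def by (rule subspace_keys)

lemma Sym_le_subset_Sym: "Sym_le N n \<subseteq> Sym N"
  by (auto simp: Sym_le_def)

lemma Sym_obtain_le:
  assumes "P \<in> Sym N"
  obtains n where "P \<in> Sym_le N n"
proof
  show "P \<in> Sym_le N (\<Sum>\<alpha>\<in>Poly_Mapping.keys P. mdeg \<alpha>)"
    using assms by (auto simp: Sym_le_def total_degree_le_def intro: member_le_sum)
qed

lemma linear_eq_0_on_keys:
  assumes "linear f" "Poly_Mapping.keys (P :: gpoly) \<subseteq> S" "\<And>\<alpha>. \<alpha> \<in> S \<Longrightarrow> f (monom_of \<alpha>) = 0"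
  shows "f P = (0 :: real)"
proof -
  have "P \<in> Real_Vector_Spaces.span (monom_of ` S)" using assms(2) by (simp add: span_monom_of)
  then show ?thesis
    by (rule linear_eq_0_on_span[OF assms(1), rotated]) (auto simp: assms(3))
qed

section \<open>Degrees of monomials\<close>

lemma mdeg_superset:
  assumes "finite K" "Poly_Mapping.keys \<alpha> \<subseteq> K"
  shows "mdeg \<alpha> = (\<Sum>x\<in>K. fst x * Poly_Mapping.lookup \<alpha> x)"
  unfolding mdeg_def
  using assms by (auto simp: case_prod_unfold in_keys_iff intro!: sum.mono_neutral_left)

lemma mdeg_add: "mdeg (\<alpha> + \<beta>) = mdeg \<alpha> + mdeg \<beta>"
proof -
  let ?K = "Poly_Mapping.keys \<alpha> \<union> Poly_Mapping.keys \<beta>"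
  have "Poly_Mapping.keys (\<alpha> + \<beta>) \<subseteq> ?K" by (rule keys_add)
  then show ?thesis
    by (simp add: mdeg_superset[of ?K] lookup_add distrib_left sum.distrib)
qed

lemma mdeg_zero [simp]: "mdeg 0 = 0"
  by (simp add: mdeg_def)

lemma mdeg_single [simp]: "mdeg (Poly_Mapping.single (m, i) 1) = m"
  by (simp add: mdeg_def)

lemma monoms_add: "\<alpha> \<in> monoms N \<Longrightarrow> \<beta> \<in> monoms N \<Longrightarrow> \<alpha> + \<beta> \<in> monoms N"
  using keys_add[of \<alpha> \<beta>] by (auto simp: monoms_def)

lemma zero_in_monoms [simp]: "0 \<in> monoms N"
  by (simp add: monoms_def)

lemma single_in_monoms: "1 \<le> m \<Longrightarrow> i \<in> {1..N m} \<Longrightarrow> Poly_Mapping.single (m, i) 1 \<in> monoms N"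
  by (simp add: monoms_def)

text \<open>Every monomial except \<open>1\<close> is an indeterminate times a monomial of smaller degree. This is what the
  inductions on the degree below run on.\<close>

lemma monom_cases:
  assumes "\<alpha> \<in> monoms N"
  obtains "\<alpha> = 0"
  | m i \<beta> where "1 \<le> m" "i \<in> {1..N m}" "\<beta> \<in> monoms N" "\<alpha> = Poly_Mapping.single (m, i) 1 + \<beta>"
      "mdeg \<alpha> = m + mdeg \<beta>" "monom_of \<alpha> = indet m i * monom_of \<beta>"
proof (cases "\<alpha> = 0")
  case False
  then obtain m i where mi: "(m, i) \<in> Poly_Mapping.keys \<alpha>"
    by (metis keys_eq_empty all_not_in_conv surj_pair)
  define \<beta> where "\<beta> = \<alpha> - Poly_Mapping.single (m, i) 1"
  have \<alpha>: "\<alpha> = Poly_Mapping.single (m, i) 1 + \<beta>"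
    using mi by (intro poly_mapping_eqI)
      (auto simp: \<beta>_def lookup_add lookup_minus lookup_single when_def in_keys_iff)
  have "Poly_Mapping.keys \<beta> \<subseteq> Poly_Mapping.keys \<alpha>"
    by (auto simp: \<beta>_def in_keys_iff lookup_minus)
  then have "\<beta> \<in> monoms N" "1 \<le> m" "i \<in> {1..N m}"
    using mi assms by (auto simp: monoms_def)
  moreover have "mdeg \<alpha> = m + mdeg \<beta>"
    unfolding \<alpha> mdeg_add mdeg_single ..
  moreover have "monom_of \<alpha> = indet m i * monom_of \<beta>"
    unfolding \<alpha> indet_def mult_single by simp
  ultimately show ?thesis using \<alpha> that(2) by blast
qed auto

lemma Sym_le_mult: "P \<in> Sym_le N a \<Longrightarrow> Q \<in> Sym_le N b \<Longrightarrow> P * Q \<in> Sym_le N (a + b)"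
proof -
  assume "P \<in> Sym_le N a" "Q \<in> Sym_le N b"
  then have "\<alpha> + \<beta> \<in> {\<gamma> \<in> monoms N. mdeg \<gamma> \<le> a + b}"
    if "\<alpha> \<in> Poly_Mapping.keys P" "\<beta> \<in> Poly_Mapping.keys Q" for \<alpha> \<beta>
    using that by (auto simp: Sym_le_eq mdeg_add intro!: monoms_add add_mono)
  then show ?thesis using keys_mult[of P Q] unfolding Sym_le_eq by blast
qed

lemma Sym_mult: "P \<in> Sym N \<Longrightarrow> Q \<in> Sym N \<Longrightarrow> P * Q \<in> Sym N"
  using keys_mult[of P Q] unfolding Sym_def by (blast intro: monoms_add)

lemma indet_in_Sym_le: "1 \<le> m \<Longrightarrow> i \<in> {1..N m} \<Longrightarrow> indet m i \<in> Sym_le N m"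
  unfolding Sym_le_eq indet_def by (simp add: single_in_monoms del: One_nat_def)

lemma indet_mult_in_Sym_le:
  assumes "1 \<le> m" "i \<in> {1..N m}" "P \<in> Sym_le N a"
  shows "indet m i * P \<in> Sym_le N (a + m)"
  using Sym_le_mult[OF assms(3) indet_in_Sym_le[of m i N]] assms(1,2) by (simp add: mult.commute)

lemma monom_of_in_Sym_le: "\<alpha> \<in> monoms N \<Longrightarrow> mdeg \<alpha> \<le> n \<Longrightarrow> monom_of \<alpha> \<in> Sym_le N n"
  by (simp add: Sym_le_eq)

text \<open>Multiplication by an indeterminate shifts the support; no cancellation can occur.\<close>

lemma keys_indet_mult:
  "Poly_Mapping.keys (indet m i * P) = (\<lambda>\<alpha>. Poly_Mapping.single (m, i) 1 + \<alpha>) ` Poly_Mapping.keys P"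
proof -
  let ?s = "Poly_Mapping.single (m, i) 1 :: gmonom"
  have "indet m i * P
      = (\<Sum>\<alpha>\<in>Poly_Mapping.keys P. Poly_Mapping.lookup P \<alpha> *\<^sub>R monom_of (?s + \<alpha>))"
    by (subst (1) monomial_expansion[of P])
       (simp add: sum_distrib_left indet_def mult_single)
  then have "Poly_Mapping.lookup (indet m i * P) \<gamma>
      = (\<Sum>\<alpha>\<in>Poly_Mapping.keys P. if ?s + \<alpha> = \<gamma> then Poly_Mapping.lookup P \<alpha> else 0)" for \<gamma>
    by (simp add: lookup_sum lookup_scaleR lookup_single when_def if_distrib cong: if_cong)
  then have 1: "Poly_Mapping.lookup (indet m i * P) (?s + \<beta>) = Poly_Mapping.lookup P \<beta>" for \<beta>
    by (simp add: in_keys_iff)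
  have "Poly_Mapping.keys (indet m i * P) \<subseteq> (\<lambda>\<alpha>. ?s + \<alpha>) ` Poly_Mapping.keys P"
    using keys_mult[of "indet m i" P] by (auto simp: indet_def)
  then show ?thesis using 1 by (auto simp: in_keys_iff)
qed

lemma monoms_of_degree_0: "monoms_of_degree N 0 = {0}"
proof -
  have "\<alpha> = 0" if "\<alpha> \<in> monoms N" "mdeg \<alpha> = 0" for \<alpha>
    using that(1) by (cases rule: monom_cases) (use that(2) in auto)
  then show ?thesis by (auto simp: monoms_of_degree_def)
qed

lemma r_0: "r N 0 = 1"
  by (simp add: r_def monoms_of_degree_0)

lemma monoms_le_eq: "{\<alpha> \<in> monoms N. mdeg \<alpha> \<le> n} = (\<Union>k\<le>n. monoms_of_degree N k)"
  by (auto simp: monoms_of_degree_def)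

lemma card_monoms_le: "card {\<alpha> \<in> monoms N. mdeg \<alpha> \<le> n} = (\<Sum>k\<le>n. r N k)"
  unfolding monoms_le_eq r_def
proof (rule card_UN_disjoint)
  show "\<forall>i\<in>{..n}. \<forall>j\<in>{..n}. i \<noteq> j \<longrightarrow> monoms_of_degree N i \<inter> monoms_of_degree N j = {}"
    by (auto simp: monoms_of_degree_def)
qed (simp_all add: finite_monoms_of_degree)

text \<open>Access to \<open>\<^bold>w\<^sub>n\<close> that is independent of the unspecified order of the monomials.\<close>

lemma is_monom_vecD:
  assumes "is_monom_vec N n v"
  shows "dim_vec v = r N n" "a < r N n \<Longrightarrow> \<exists>\<alpha>\<in>monoms_of_degree N n. v $ a = monom_of \<alpha>"
    "\<alpha> \<in> monoms_of_degree N n \<Longrightarrow> \<exists>a<r N n. v $ a = monom_of \<alpha>"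
proof -
  obtain \<alpha>s where \<alpha>s: "distinct \<alpha>s" "set \<alpha>s = monoms_of_degree N n"
      "v = vec_of_list (map monom_of \<alpha>s)"
    using assms by (auto simp: is_monom_vec_def)
  have len: "length \<alpha>s = r N n" using \<alpha>s distinct_card by (fastforce simp: r_def)
  then show "dim_vec v = r N n" by (simp add: \<alpha>s)
  have idx: "v $ a = monom_of (\<alpha>s ! a)" if "a < r N n" for a
    using that len by (simp add: \<alpha>s vec_of_list_index)
  show "a < r N n \<Longrightarrow> \<exists>\<alpha>\<in>monoms_of_degree N n. v $ a = monom_of \<alpha>"
    using idx len \<alpha>s(2) nth_mem by metis
  show "\<alpha> \<in> monoms_of_degree N n \<Longrightarrow> \<exists>a<r N n. v $ a = monom_of \<alpha>"
    using idx len \<alpha>s(2) by (metis in_set_conv_nth)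
qed

section \<open>Full rank and trivial kernels\<close>

lemma index_mult_mat_vec_sum:
  "A \<in> carrier_mat nr nc \<Longrightarrow> a < nr \<Longrightarrow> dim_vec v = nc \<Longrightarrow>
    (A *\<^sub>v v) $ a = (\<Sum>b<nc. A $$ (a, b) * v $ b)"
  by (simp add: scalar_prod_def atLeast0LessThan)

lemma mult_mat_vec_eq_0_iff:
  "A \<in> carrier_mat nr nc \<Longrightarrow> dim_vec v = nc \<Longrightarrow>
    A *\<^sub>v v = 0\<^sub>v nr \<longleftrightarrow> (\<forall>a<nr. (\<Sum>b<nc. A $$ (a, b) * v $ b) = 0)"
  by (auto simp: vec_eq_iff index_mult_mat_vec_sum simp del: index_mult_mat_vec)

lemma mat_unit_vec_col:
  "A \<in> carrier_mat nr nc \<Longrightarrow> j < nc \<Longrightarrow> A *\<^sub>v unit_vec nc j = col A (j :: nat)" for A :: "real mat"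
  by (auto simp: vec_eq_iff)

lemma mat_rank_eq_dim_col:
  assumes A: "A \<in> carrier_mat nr nc"
    and ker: "\<And>v. v \<in> carrier_vec nc \<Longrightarrow> A *\<^sub>v v = 0\<^sub>v nr \<Longrightarrow> v = 0\<^sub>v nc"
  shows "mat_rank A = nc"
proof -
  have dist: "distinct (cols A)"
    unfolding distinct_conv_nth
  proof (intro allI impI)
    fix i j assume ij: "i < length (cols A)" "j < length (cols A)" "i \<noteq> j"
    show "cols A ! i \<noteq> cols A ! j"
    proof
      assume "cols A ! i = cols A ! j"
      then have "col A i = col A j" using ij by simp
      then have "A *\<^sub>v (unit_vec nc i - unit_vec nc j) = 0\<^sub>v nr"
        using A ij by (subst mult_minus_distrib_mat_vec[of A nr nc]) (auto simp: mat_unit_vec_col)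
      then have "unit_vec nc i - unit_vec nc j = (0\<^sub>v nc :: real vec)" using ker by auto
      then have "(unit_vec nc i - unit_vec nc j :: real vec) $ i = 0" using A ij by simp
      then show False using A ij by simp
    qed
  qed
  have "vec_space.rank nr A = nc"
    using vec_space.lin_indpt_full_rank[OF A dist] vec_space.lin_depE[OF A _ dist] ker by blast
  then show ?thesis using A by (simp add: mat_rank_def)
qed

text \<open>A matrix is onto, hence has full row rank, as soon as its transpose is injective, because then
  \<open>A A\<^sup>T\<close> is injective.\<close>

lemma mat_rank_eq_dim_row:
  assumes A: "A \<in> carrier_mat nr nc"
    and ker: "\<And>v. v \<in> carrier_vec nr \<Longrightarrow> transpose_mat A *\<^sub>v v = 0\<^sub>v nc \<Longrightarrow> v = 0\<^sub>v nr"
  shows "mat_rank A = nr"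
proof -
  interpret vec_space "TYPE(real)" nr .
  let ?G = "A * transpose_mat A"
  have At: "transpose_mat A \<in> carrier_mat nc nr" using A by simp
  have G: "?G \<in> carrier_mat nr nr" using A by simp
  have "v = 0\<^sub>v nr" if v: "v \<in> carrier_vec nr" and 0: "?G *\<^sub>v v = 0\<^sub>v nr" for v
  proof (rule ker[OF v])
    let ?u = "transpose_mat A *\<^sub>v v"
    have u: "?u \<in> carrier_vec nc" using At v by simp
    have "?u \<bullet> ?u = v \<bullet> (A *\<^sub>v ?u)"
      using transpose_vec_mult_scalar[OF A u v] by simp
    also have "A *\<^sub>v ?u = 0\<^sub>v nr" using 0 assoc_mult_mat_vec[OF A At v] by simp
    finally have "?u \<bullet> ?u = 0" using v by simp
    then have "(\<Sum>i<nc. (?u $ i)\<^sup>2) = 0"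
      unfolding scalar_prod_def using carrier_vecD[OF u]
      by (simp add: atLeast0LessThan power2_eq_square del: index_mult_mat_vec)
    then show "?u = 0\<^sub>v nc" using u A by (auto simp: sum_nonneg_eq_0_iff intro!: eq_vecI simp del: index_mult_mat_vec)
  qed
  then have "det ?G \<noteq> 0" using det_0_iff_vec_prod_zero_field[OF G] by blast
  then have "?G \<in> Units (ring_mat TYPE(real) nr ())" by (rule det_non_zero_imp_unit[OF G])
  then obtain B where B: "B \<in> carrier_mat nr nr" "?G * B = 1\<^sub>m nr"
    by (auto simp: Units_def ring_mat_def)
  have "\<exists>x\<in>carrier_vec nc. A *\<^sub>v x = y" if y: "y \<in> carrier_vec nr" for y
  proof
    show "A *\<^sub>v (transpose_mat A *\<^sub>v (B *\<^sub>v y)) = y"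
      using assoc_mult_mat_vec[OF A At, of "B *\<^sub>v y"] assoc_mult_mat_vec[OF G B(1) y] B y by simp
  qed (use At B y in simp)
  then have "span (set (cols A)) = carrier_vec nr"
    using col_space_eq[OF A] A by (auto simp: col_space_def)
  then have "span_vs (set (cols A)) = V" by simp
  then show ?thesis using A dim_is_n by (simp add: mat_rank_def rank_def)
qed

lemma stack_carrier:
  assumes "\<And>A. A \<in> set As \<Longrightarrow> dim_col A = nc"
  shows "dim_col (stack nc As) = nc"
  using assms
proof (induction As)
  case (Cons A As)
  have "A \<in> carrier_mat (dim_row A) nc" "stack nc As \<in> carrier_mat (dim_row (stack nc As)) nc"
    using Cons by (auto intro!: carrier_matI)
  from carrier_append_rows[OF this] show ?case by (auto simp: stack_def)
qed (simp add: stack_def)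

lemma stack_kernel:
  assumes "\<And>A. A \<in> set As \<Longrightarrow> dim_col A = nc" "v \<in> carrier_vec nc"
    "stack nc As *\<^sub>v v = 0\<^sub>v (dim_row (stack nc As))" "A \<in> set As"
  shows "A *\<^sub>v v = 0\<^sub>v (dim_row A)"
  using assms
proof (induction As)
  case (Cons B As)
  let ?S = "stack nc As"
  have B: "B \<in> carrier_mat (dim_row B) nc" using Cons.prems by auto
  have S: "?S \<in> carrier_mat (dim_row ?S) nc" using stack_carrier[of As nc] Cons.prems by auto
  have eq: "stack nc (B # As) = append_rows B ?S" by (simp add: stack_def)
  have dim: "dim_row (append_rows B ?S) = dim_row B + dim_row ?S"
    using carrier_append_rows[OF B S] by blast
  have "(B *\<^sub>v v) @\<^sub>v (?S *\<^sub>v v) = 0\<^sub>v (dim_row B) @\<^sub>v 0\<^sub>v (dim_row ?S)"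
    using Cons.prems(3) unfolding eq dim mat_mult_append[OF B S Cons.prems(2)]
    by (auto simp: vec_eq_iff)
  then have "B *\<^sub>v v = 0\<^sub>v (dim_row B)" "?S *\<^sub>v v = 0\<^sub>v (dim_row ?S)"
    using append_vec_eq[of "B *\<^sub>v v" "dim_row B" "0\<^sub>v (dim_row B)"]
    by (metis B carrier_vecI dim_mult_mat_vec index_zero_vec(2))+
  then show ?case using Cons by auto
qed simp

section \<open>The recurrence in coordinates\<close>

lemma mat_act_closed: "A \<in> carrier_mat nr nc \<Longrightarrow> mat_act A v \<in> carrier_vec nr"
  by (rule carrier_vecI) (simp add: mat_act_def)

lemma mat_act_index:
  assumes "A \<in> carrier_mat nr nc" "v \<in> carrier_vec nc" "j < nr"
  shows "mat_act A v $ j = (\<Sum>l<nc. A $$ (j, l) *\<^sub>R v $ l)"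
  using assms by (simp add: mat_act_def scalar_prod_def scaleR_eq_const_mult atLeast0LessThan)

text \<open>The coefficient of the entry \<open>p b $ l\<close> in \<open>w\<^sub>m\<^sub>,\<^sub>i * p a $ j\<close> that the matrices \<open>M\<close> prescribe. It comes from
  the first sum of the recurrence if \<open>a \<le> b\<close>, from the transposed matrices of the second sum if
  \<open>a - m \<le> b < a\<close>, and vanishes for \<open>b < a - m\<close>. With this single coefficient the two sums of the
  recurrence for \<open>n = a + m\<close> become one sum over all \<open>b \<le> n\<close>.\<close>

definition rec_coeff ::
  "(nat \<Rightarrow> nat \<Rightarrow> nat \<Rightarrow> nat \<Rightarrow> real mat) \<Rightarrow> nat \<Rightarrow> nat \<Rightarrow> nat \<Rightarrow> nat \<Rightarrow> nat \<Rightarrow> nat \<Rightarrow> real" where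
  "rec_coeff M m i a b j l =
     (if a \<le> b then M (b - a) (a + m) m i $$ (j, l)
      else if a \<le> b + m then M (a - b) (b + m) m i $$ (l, j) else 0)"

lemma vector_recurrence_iff:
  assumes p: "\<And>n. p n \<in> carrier_vec (r N n)"
    and M: "\<And>n m i k. \<lbrakk>m \<in> {1..n}; i \<in> {1..N m}; k \<in> {0..m}\<rbrakk> \<Longrightarrow>
      M k n m i \<in> carrier_mat (r N (n - m)) (r N (n - m + k))"
    and m: "m \<in> {1..n}" and i: "i \<in> {1..N m}"
  shows "indet m i \<cdot>\<^sub>v p (n - m) =
      finsum_vec TYPE(gpoly) (r N (n - m))
        (\<lambda>k. mat_act (M k n m i) (p (n - m + k))) {0..m} +
      finsum_vec TYPE(gpoly) (r N (n - m))
        (\<lambda>k. mat_act (transpose_mat (M k (n - k) m i)) (p (n - m - k)))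
        {k \<in> {1..m}. m + k \<le> n} \<longleftrightarrow>
    (\<forall>j<r N (n - m). indet m i * p (n - m) $ j =
      (\<Sum>b\<le>n. \<Sum>l<r N b. rec_coeff M m i (n - m) b j l *\<^sub>R p b $ l))"
    (is "?v = ?S1 + ?S2 \<longleftrightarrow> _")
proof -
  define a where "a = n - m"
  have n: "n = a + m" using m by (simp add: a_def)
  let ?U1 = "\<lambda>k. mat_act (M k n m i) (p (a + k))"
  let ?U2 = "\<lambda>k. mat_act (transpose_mat (M k (n - k) m i)) (p (a - k))"
  let ?K = "{k \<in> {1..m}. m + k \<le> n}"
  have M1: "M k n m i \<in> carrier_mat (r N a) (r N (a + k))" if "k \<in> {0..m}" for k
    using M[OF m i that] by (simp add: a_def)
  have M2: "transpose_mat (M k (n - k) m i) \<in> carrier_mat (r N a) (r N (a - k))" if "k \<in> ?K" for k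
    using M[of m "n - k" i k] i m that by (auto simp: n)
  have U1: "?U1 \<in> {0..m} \<rightarrow> carrier_vec (r N a)" and U2: "?U2 \<in> ?K \<rightarrow> carrier_vec (r N a)"
    using mat_act_closed M1 M2 by blast+
  have c: "finsum_vec TYPE(gpoly) (r N a) ?U1 {0..m} \<in> carrier_vec (r N a)"
      "finsum_vec TYPE(gpoly) (r N a) ?U2 ?K \<in> carrier_vec (r N a)"
    using finsum_vec_closed U1 U2 by blast+
  have "(finsum_vec TYPE(gpoly) (r N a) ?U1 {0..m} + finsum_vec TYPE(gpoly) (r N a) ?U2 ?K) $ j
      = (\<Sum>b\<le>n. \<Sum>l<r N b. rec_coeff M m i a b j l *\<^sub>R p b $ l)" if j: "j < r N a" for j
  proof -
    let ?f = "\<lambda>b. \<Sum>l<r N b. rec_coeff M m i a b j l *\<^sub>R p b $ l"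
    have "finsum_vec TYPE(gpoly) (r N a) ?U1 {0..m} $ j = (\<Sum>k\<in>{0..m}. ?f (a + k))"
      unfolding index_finsum_vec[OF _ j U1, simplified]
      by (rule sum.cong[OF refl], subst mat_act_index[OF M1 p j])
         (auto simp: rec_coeff_def n)
    also have "\<dots> = (\<Sum>b\<in>{a..n}. ?f b)"
      by (rule sum.reindex_bij_witness[of _ "\<lambda>b. b - a" "\<lambda>k. a + k"]) (auto simp: n)
    finally have 1: "finsum_vec TYPE(gpoly) (r N a) ?U1 {0..m} $ j = (\<Sum>b\<in>{a..n}. ?f b)" .
    have "finsum_vec TYPE(gpoly) (r N a) ?U2 ?K $ j = (\<Sum>k\<in>?K. ?U2 k $ j)"
      by (rule index_finsum_vec[OF _ j U2]) simp
    also have "\<dots> = (\<Sum>k\<in>?K. ?f (a - k))"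
    proof (rule sum.cong[OF refl])
      fix k assume k: "k \<in> ?K"
      then have k': "k \<le> a" "1 \<le> k" "k \<le> m" by (auto simp: n)
      have d: "M k (n - k) m i \<in> carrier_mat (r N (a - k)) (r N a)"
        using M2[OF k] by simp
      show "?U2 k $ j = ?f (a - k)"
        unfolding mat_act_index[OF M2[OF k] p j] using k' d j
        by (intro sum.cong) (auto simp: rec_coeff_def n)
    qed
    also have "\<dots> = (\<Sum>b\<in>{b. b < a \<and> a \<le> b + m}. ?f b)"
      by (rule sum.reindex_bij_witness[of _ "\<lambda>b. a - b" "\<lambda>k. a - k"]) (auto simp: n)
    also have "\<dots> = (\<Sum>b\<in>{..<a}. ?f b)"
      by (rule sum.mono_neutral_left) (auto simp: rec_coeff_def)
    finally have 2: "finsum_vec TYPE(gpoly) (r N a) ?U2 ?K $ j = (\<Sum>b\<in>{..<a}. ?f b)" .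
    have "{..n} = {a..n} \<union> {..<a}" "{a..n} \<inter> {..<a} = {}" by (auto simp: n)
    then have "(\<Sum>b\<le>n. ?f b) = (\<Sum>b\<in>{a..n}. ?f b) + (\<Sum>b\<in>{..<a}. ?f b)"
      by (simp add: sum.union_disjoint)
    then show ?thesis using 1 2 c j by simp
  qed
  then show ?thesis
    using p[of a] c unfolding a_def[symmetric] vec_eq_iff by auto
qed

section \<open>From orthonormality to the recurrence\<close>

text \<open>Values of a functional outside \<open>Sym N\<close> do not matter, so it may be taken to be linear everywhere.\<close>

lemma linear_functional_extend:
  assumes "positive_definite N L"
  obtains L' where "linear L'" "\<And>P. P \<in> Sym N \<Longrightarrow> L' P = L P"
proof -
  obtain B where B: "\<not> Real_Vector_Spaces.dependent B" "Real_Vector_Spaces.span B = Sym N"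
    and L: "linear_functional N L"
    using assms by (auto simp: positive_definite_def is_basis_Sym_def)
  obtain L' where L': "linear L'" "\<forall>x\<in>B. L' x = L x"
    using linear_independent_extend[OF B(1)] by blast
  have zero: "0 \<in> Sym N" by (simp add: Sym_def)
  have "L 0 = 0" using L zero unfolding linear_functional_def by (metis mult_zero_left scaleR_zero_left)
  then have sub: "Real_Vector_Spaces.subspace {x \<in> Sym N. L' x = L x}"
    using L subspace_Sym[of N] zero
    unfolding real_vector.subspace_def linear_functional_def
    by (auto simp: linear_add[OF L'(1)] linear_scale[OF L'(1)] linear_0[OF L'(1)])
  have B_sub: "B \<subseteq> {x \<in> Sym N. L' x = L x}"
    using L'(2) B(2) real_vector.span_superset[of B] by auto
  have "Sym N \<subseteq> {x \<in> Sym N. L' x = L x}"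
    using real_vector.span_minimal[OF B_sub sub] unfolding B(2) .
  then show ?thesis using that L'(1) by blast
qed

text \<open>The situation of an orthonormal sequence, in terms of entries, for a functional that is linear on
  the whole ambient space. The assumption \<open>low\<close> is \<open>(\<^bold>w\<^sub>m, p\<^sub>n\<^sup>T) = 0\<close> for \<open>m < n\<close>, and \<open>nondeg\<close> says that
  the square matrix \<open>(\<^bold>w\<^sub>n, p\<^sub>n\<^sup>T)\<close> is injective. Of the basis property only \<open>total\<close>, the spanning part, is kept.\<close>

locale orthonormal_system =
  fixes N :: "nat \<Rightarrow> nat" and p :: "nat \<Rightarrow> gpoly vec" and L :: "gpoly \<Rightarrow> real"
  assumes lin: "linear L"
    and p_Sym_le: "\<And>n j. j < r N n \<Longrightarrow> p n $ j \<in> Sym_le N n"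
    and low: "\<And>n j \<alpha>. \<lbrakk>\<alpha> \<in> monoms N; mdeg \<alpha> < n; j < r N n\<rbrakk> \<Longrightarrow> L (monom_of \<alpha> * p n $ j) = 0"
    and nondeg: "\<And>n c j. \<lbrakk>\<And>\<alpha>. \<alpha> \<in> monoms_of_degree N n \<Longrightarrow>
        (\<Sum>l<r N n. c l * L (monom_of \<alpha> * p n $ l)) = 0; j < r N n\<rbrakk> \<Longrightarrow> c j = 0"
    and normal: "\<And>n a b. \<lbrakk>a < r N n; b < r N n\<rbrakk> \<Longrightarrow> L (p n $ a * p n $ b) = of_bool (a = b)"
    and total: "Sym N \<subseteq> Real_Vector_Spaces.span {p k $ l | k l. l < r N k}"
begin

lemma L_low_poly:
  assumes "Poly_Mapping.keys P \<subseteq> {\<alpha> \<in> monoms N. mdeg \<alpha> < n}" "j < r N n"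
  shows "L (P * p n $ j) = 0"
proof (rule linear_eq_0_on_keys[OF _ assms(1)])
  show "linear (\<lambda>P. L (P * p n $ j))"
    using linear_compose[OF linear_mult_right lin] by (simp add: o_def)
qed (use low assms(2) in auto)

lemma L_Sym_le: "P \<in> Sym_le N m \<Longrightarrow> m < n \<Longrightarrow> j < r N n \<Longrightarrow> L (P * p n $ j) = 0"
  by (rule L_low_poly) (auto simp: Sym_le_eq)

lemma L_orthonormal:
  assumes "j < r N n" "l < r N k"
  shows "L (p n $ j * p k $ l) = of_bool (n = k \<and> j = l)"
proof -
  consider "n < k" | "k < n" | "n = k" by linarith
  then show ?thesis
  proof cases
    case 2
    then show ?thesis using L_Sym_le[OF p_Sym_le, of l k n j] assms by (simp add: mult.commute)
  qed (use L_Sym_le[OF p_Sym_le, of j n k l] normal assms in auto)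
qed

lemma L_double_sum:
  "L (\<Sum>k\<in>K. \<Sum>l\<in>J k. c k l *\<^sub>R f k l) = (\<Sum>k\<in>K. \<Sum>l\<in>J k. c k l * L (f k l))"
  by (simp add: linear_sum[OF lin] linear_scale[OF lin])

text \<open>Truncation at any sufficiently large order is exact; \<open>Fourier_expansion\<close> sharpens the order to the
  degree of \<open>P\<close>.\<close>

lemma Fourier_expansion_eventually:
  assumes "P \<in> Sym N"
  shows "\<exists>n\<^sub>0. \<forall>n\<ge>n\<^sub>0. P = (\<Sum>k\<le>n. \<Sum>l<r N k. L (P * p k $ l) *\<^sub>R p k $ l)"
proof -
  have "P \<in> Real_Vector_Spaces.span {p k $ l | k l. l < r N k}" using assms total by blast
  then show ?thesis
  proof (induction rule: real_vector.span_induct_alt)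
    case base
    then show ?case by (simp add: linear_0[OF lin])
  next
    case (step c x y)
    from step.hyps obtain n j where x: "x = p n $ j" "j < r N n" by blast
    from step.IH obtain n\<^sub>0 where
      n\<^sub>0: "\<And>K. K \<ge> n\<^sub>0 \<Longrightarrow> y = (\<Sum>k\<le>K. \<Sum>l<r N k. L (y * p k $ l) *\<^sub>R p k $ l)" by blast
    have x_exp: "(\<Sum>k\<le>K. \<Sum>l<r N k. L (x * p k $ l) *\<^sub>R p k $ l) = x" if "K \<ge> n" for K
    proof -
      have "(\<Sum>l<r N k. L (x * p k $ l) *\<^sub>R p k $ l) = (if k = n then x else 0)" for k
      proof -
        have "(\<Sum>l<r N k. L (x * p k $ l) *\<^sub>R p k $ l)
            = (\<Sum>l<r N k. if l = j then (if k = n then x else 0) else 0)"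
          by (rule sum.cong) (auto simp: x L_orthonormal)
        then show ?thesis using x by auto
      qed
      then show ?thesis using that by simp
    qed
    show ?case
    proof (intro exI allI impI)
      fix K assume K: "K \<ge> max n n\<^sub>0"
      then have "c *\<^sub>R x + y = c *\<^sub>R (\<Sum>k\<le>K. \<Sum>l<r N k. L (x * p k $ l) *\<^sub>R p k $ l)
          + (\<Sum>k\<le>K. \<Sum>l<r N k. L (y * p k $ l) *\<^sub>R p k $ l)"
        using x_exp[of K] n\<^sub>0[of K] by auto
      also have "\<dots> = (\<Sum>k\<le>K. \<Sum>l<r N k. L ((c *\<^sub>R x + y) * p k $ l) *\<^sub>R p k $ l)"
        by (simp add: linear_add[OF lin] linear_scale[OF lin] distrib_right scaleR_add_left
            sum.distrib scaleR_sum_right)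
      finally show "c *\<^sub>R x + y = (\<Sum>k\<le>K. \<Sum>l<r N k. L ((c *\<^sub>R x + y) * p k $ l) *\<^sub>R p k $ l)" .
    qed
  qed
qed

lemma Fourier_expansion:
  assumes "P \<in> Sym_le N n"
  shows "P = (\<Sum>k\<le>n. \<Sum>l<r N k. L (P * p k $ l) *\<^sub>R p k $ l)"
proof -
  have "P \<in> Sym N" using assms Sym_le_subset_Sym by blast
  then obtain n\<^sub>0 where n\<^sub>0: "\<And>K. K \<ge> n\<^sub>0 \<Longrightarrow> P = (\<Sum>k\<le>K. \<Sum>l<r N k. L (P * p k $ l) *\<^sub>R p k $ l)"
    using Fourier_expansion_eventually by blast
  have "P = (\<Sum>k\<le>max n n\<^sub>0. \<Sum>l<r N k. L (P * p k $ l) *\<^sub>R p k $ l)" by (rule n\<^sub>0) simp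
  also have "\<dots> = (\<Sum>k\<le>n. \<Sum>l<r N k. L (P * p k $ l) *\<^sub>R p k $ l)"
    by (rule sum.mono_neutral_right) (auto simp: L_Sym_le[OF assms])
  finally show ?thesis .
qed

lemma indet_mult_Sym_le:
  "\<lbrakk>1 \<le> m; i \<in> {1..N m}; j < r N a\<rbrakk> \<Longrightarrow> indet m i * p a $ j \<in> Sym_le N (a + m)"
  by (intro indet_mult_in_Sym_le p_Sym_le)

text \<open>The matrix \<open>M\<^sup>k\<^sub>n\<^sub>,\<^sub>m\<^sub>,\<^sub>i = (w\<^sub>m\<^sub>,\<^sub>i p\<^sub>n\<^sub>-\<^sub>m, p\<^sub>n\<^sub>-\<^sub>m\<^sub>+\<^sub>k\<^sup>T)\<close> of Fourier coefficients.\<close>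

definition moment_mat :: "nat \<Rightarrow> nat \<Rightarrow> nat \<Rightarrow> nat \<Rightarrow> real mat" where
  "moment_mat k n m i = mat (r N (n - m)) (r N (n - m + k))
     (\<lambda>(j, l). L (indet m i * p (n - m) $ j * p (n - m + k) $ l))"

lemma moment_mat_carrier: "moment_mat k n m i \<in> carrier_mat (r N (n - m)) (r N (n - m + k))"
  by (simp add: moment_mat_def)

text \<open>The transposed matrices in the recurrence come from \<open>L ((w P) Q) = L ((w Q) P)\<close>, and the recurrence
  stops at \<open>b = a - m\<close> because \<open>w Q\<close> has degree less than \<open>a\<close> when \<open>Q\<close> has degree less than \<open>a - m\<close>.\<close>

lemma rec_coeff_moment_mat:
  assumes "1 \<le> m" "i \<in> {1..N m}" "j < r N a" "l < r N b"
  shows "rec_coeff moment_mat m i a b j l = L (indet m i * p a $ j * p b $ l)"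
proof -
  consider "a \<le> b" | "b < a" "a \<le> b + m" | "b + m < a" by linarith
  then show ?thesis
  proof cases
    case 3
    have "L (indet m i * p b $ l * p a $ j) = 0"
      using L_Sym_le[OF indet_mult_Sym_le] 3 assms by blast
    then show ?thesis using 3 by (simp add: rec_coeff_def mult_ac)
  qed (use assms in \<open>auto simp: rec_coeff_def moment_mat_def mult_ac\<close>)
qed

lemma recurrence_moment_mat:
  assumes "1 \<le> m" "i \<in> {1..N m}" "j < r N a"
  shows "indet m i * p a $ j =
    (\<Sum>b\<le>a + m. \<Sum>l<r N b. rec_coeff moment_mat m i a b j l *\<^sub>R p b $ l)"
  using assms by (subst Fourier_expansion[OF indet_mult_Sym_le[OF assms]])
    (simp add: rec_coeff_moment_mat del: One_nat_def)

text \<open>A linear relation between the rows of \<open>A\<^sub>n\<^sub>,\<^sub>m\<^sub>,\<^sub>i\<close> gives a combination \<open>Q\<close> of the entries of \<open>p\<^sub>n\<^sub>-\<^sub>m\<close> for which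
  \<open>w\<^sub>m\<^sub>,\<^sub>i Q\<close> is orthogonal to \<open>p\<^sub>n\<close>. Hence \<open>w\<^sub>m\<^sub>,\<^sub>i Q\<close> has degree less than \<open>n\<close>, so \<open>Q\<close> has degree less than
  \<open>n - m\<close> and is orthogonal to \<open>p\<^sub>n\<^sub>-\<^sub>m\<close>.\<close>

lemma moment_mat_rows_independent:
  assumes mi: "m \<in> {1..n}" "i \<in> {1..N m}" and v: "v \<in> carrier_vec (r N (n - m))"
    and 0: "transpose_mat (moment_mat m n m i) *\<^sub>v v = 0\<^sub>v (r N n)"
  shows "v = 0\<^sub>v (r N (n - m))"
proof -
  define a where "a = n - m"
  have n: "n = a + m" using mi by (simp add: a_def)
  have m1: "1 \<le> m" using mi by simp
  define Q where "Q = (\<Sum>j<r N a. v $ j *\<^sub>R p a $ j)"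
  have LQ: "L (R * Q) = (\<Sum>j<r N a. v $ j * L (R * p a $ j))" for R
    unfolding Q_def by (simp add: sum_distrib_left linear_sum[OF lin] linear_scale[OF lin])
  have Q: "Q \<in> Sym_le N a"
    unfolding Q_def using subspace_Sym_le p_Sym_le
    by (intro real_vector.subspace_sum real_vector.subspace_scale) auto
  have wQ: "indet m i * Q \<in> Sym_le N n"
    unfolding n by (rule indet_mult_in_Sym_le[OF m1 mi(2) Q])
  have top: "L (indet m i * Q * p n $ l) = 0" if l: "l < r N n" for l
  proof -
    have "(\<Sum>j<r N a. moment_mat m n m i $$ (j, l) * v $ j) = 0"
      using 0 v l moment_mat_carrier[of m n m i]
      by (subst (asm) mult_mat_vec_eq_0_iff[of _ _ "r N a"]) (auto simp: n)
    moreover have "L (indet m i * Q * p n $ l) = (\<Sum>j<r N a. v $ j * L (indet m i * p n $ l * p a $ j))"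
      using LQ[of "indet m i * p n $ l"] by (simp add: mult_ac)
    ultimately show ?thesis using l by (simp add: moment_mat_def n mult_ac)
  qed
  have "Poly_Mapping.keys (indet m i * Q) \<subseteq> {\<alpha> \<in> monoms N. mdeg \<alpha> < n}"
  proof -
    have "indet m i * Q = (\<Sum>k\<le>n. \<Sum>l<r N k. L (indet m i * Q * p k $ l) *\<^sub>R p k $ l)"
      by (rule Fourier_expansion[OF wQ])
    also have "\<dots> = (\<Sum>k<n. \<Sum>l<r N k. L (indet m i * Q * p k $ l) *\<^sub>R p k $ l)"
      by (simp add: top flip: lessThan_Suc_atMost)
    also have "\<dots> \<in> {P. Poly_Mapping.keys P \<subseteq> {\<alpha> \<in> monoms N. mdeg \<alpha> < n}}"
    proof (intro real_vector.subspace_sum real_vector.subspace_scale subspace_keys)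
      show "p k $ l \<in> {P. Poly_Mapping.keys P \<subseteq> {\<alpha> \<in> monoms N. mdeg \<alpha> < n}}"
        if "k \<in> {..<n}" "l \<in> {..<r N k}" for k l
        using p_Sym_le[of l k] that by (auto simp: Sym_le_eq)
    qed
    finally show ?thesis by simp
  qed
  then have "Poly_Mapping.keys Q \<subseteq> {\<alpha> \<in> monoms N. mdeg \<alpha> < a}"
    using Q unfolding keys_indet_mult by (auto simp: Sym_le_eq mdeg_add n simp del: One_nat_def)
  then have "L (Q * p a $ l) = 0" if "l < r N a" for l using L_low_poly that by blast
  moreover have "L (Q * p a $ l) = v $ l" if "l < r N a" for l
  proof -
    have "L (Q * p a $ l) = (\<Sum>j<r N a. if j = l then v $ j else 0)"
      using that LQ[of "p a $ l"] by (auto simp: mult.commute normal intro!: sum.cong)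
    then show ?thesis using that by simp
  qed
  ultimately show ?thesis using v by (auto simp: a_def)
qed

text \<open>A vector in the kernel of all \<open>A\<^sub>n\<^sub>,\<^sub>m\<^sub>,\<^sub>i\<close> gives a combination \<open>R\<close> of the entries of \<open>p\<^sub>n\<close> that is orthogonal
  to \<open>w\<^sub>m\<^sub>,\<^sub>i P\<close> for all \<open>P\<close> of degree at most \<open>n - m\<close>, hence to all monomials of degree \<open>n \<ge> 1\<close>.\<close>

lemma moment_mat_stack_injective:
  assumes n: "n \<ge> 1" and v: "v \<in> carrier_vec (r N n)"
    and 0: "\<And>m i. \<lbrakk>m \<in> {1..n}; i \<in> {1..N m}\<rbrakk> \<Longrightarrow> moment_mat m n m i *\<^sub>v v = 0\<^sub>v (r N (n - m))"
  shows "v = 0\<^sub>v (r N n)"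
proof -
  have "(\<Sum>l<r N n. v $ l * L (monom_of \<alpha> * p n $ l)) = 0" if \<alpha>: "\<alpha> \<in> monoms_of_degree N n" for \<alpha>
  proof -
    define R where "R = (\<Sum>l<r N n. v $ l *\<^sub>R p n $ l)"
    have LR: "L (P * R) = (\<Sum>l<r N n. v $ l * L (P * p n $ l))" for P
      unfolding R_def by (simp add: sum_distrib_left linear_sum[OF lin] linear_scale[OF lin])
    have "\<alpha> \<in> monoms N" "\<alpha> \<noteq> 0" using \<alpha> n by (auto simp: monoms_of_degree_def)
    then obtain m i \<beta> where mi: "1 \<le> m" "i \<in> {1..N m}" "\<beta> \<in> monoms N"
        "mdeg \<alpha> = m + mdeg \<beta>" "monom_of \<alpha> = indet m i * monom_of \<beta>"
      by (cases rule: monom_cases) auto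
    define a where "a = mdeg \<beta>"
    have na: "n = a + m" using mi \<alpha> by (simp add: a_def monoms_of_degree_def)
    have m: "m \<in> {1..n}" using mi na by simp
    have \<beta>: "monom_of \<beta> \<in> Sym_le N a" using mi by (simp add: monom_of_in_Sym_le a_def)
    have *: "L (indet m i * p k $ j * R) = 0" if k: "k \<le> a" "j < r N k" for k j
    proof (cases "k = a")
      case True
      have "(\<Sum>l<r N n. moment_mat m n m i $$ (j, l) * v $ l) = 0"
        using 0[OF m mi(2)] v k True moment_mat_carrier[of m n m i]
        by (subst (asm) mult_mat_vec_eq_0_iff[of _ _ "r N n"]) (auto simp: na)
      then show ?thesis unfolding LR using k True by (simp add: moment_mat_def na mult_ac)
    next
      case False
      then show ?thesis
        using L_Sym_le[OF indet_mult_Sym_le[OF mi(1,2) k(2)], of n] k na by (simp add: LR)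
    qed
    have "L (monom_of \<alpha> * R) = L (indet m i * R * monom_of \<beta>)"
      by (simp add: mi mult_ac)
    also have "monom_of \<beta> = (\<Sum>k\<le>a. \<Sum>l<r N k. L (monom_of \<beta> * p k $ l) *\<^sub>R p k $ l)"
      by (rule Fourier_expansion[OF \<beta>])
    also have "L (indet m i * R * \<dots>)
        = (\<Sum>k\<le>a. \<Sum>l<r N k. L (monom_of \<beta> * p k $ l) * L (indet m i * R * p k $ l))"
      by (simp add: sum_distrib_left L_double_sum)
    also have "\<dots> = 0"
      using * by (intro sum.neutral ballI) (simp add: mult_ac)
    finally show ?thesis by (simp add: LR)
  qed
  then have "v $ j = 0" if "j < r N n" for j using nondeg[of n "\<lambda>l. v $ l"] that by blast
  then show ?thesis using v by auto
qed

lemma moment_mat_ranks: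
  assumes n: "n \<ge> 1"
  shows "\<lbrakk>m \<in> {1..n}; i \<in> {1..N m}\<rbrakk> \<Longrightarrow> mat_rank (moment_mat m n m i) = r N (n - m)"
    "\<lbrakk>m \<in> {1..n}; i \<in> {1..N m}\<rbrakk> \<Longrightarrow> mat_rank (transpose_mat (moment_mat m n m i)) = r N (n - m)"
    "mat_rank (stack (r N n) (map (\<lambda>(m, i). moment_mat m n m i) (index_pairs N n))) = r N n"
proof -
  have c: "moment_mat m n m i \<in> carrier_mat (r N (n - m)) (r N n)" if "m \<in> {1..n}" for m i
    using moment_mat_carrier[of m n m i] that by simp
  show "mat_rank (moment_mat m n m i) = r N (n - m)" if "m \<in> {1..n}" "i \<in> {1..N m}"
    by (rule mat_rank_eq_dim_row[OF c]) (use that moment_mat_rows_independent in auto)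
  show "mat_rank (transpose_mat (moment_mat m n m i)) = r N (n - m)" if "m \<in> {1..n}" "i \<in> {1..N m}"
    by (rule mat_rank_eq_dim_col[of _ "r N n"]) (use that c moment_mat_rows_independent in auto)
  let ?As = "map (\<lambda>(m, i). moment_mat m n m i) (index_pairs N n)"
  have dim: "dim_col A = r N n" if "A \<in> set ?As" for A
    using that c by (auto simp: set_index_pairs)
  show "mat_rank (stack (r N n) ?As) = r N n"
  proof (rule mat_rank_eq_dim_col)
    show "stack (r N n) ?As \<in> carrier_mat (dim_row (stack (r N n) ?As)) (r N n)"
      by (rule carrier_matI[OF refl stack_carrier[OF dim]])
    fix v :: "real vec"
    assume v: "v \<in> carrier_vec (r N n)"
      and 0: "stack (r N n) ?As *\<^sub>v v = 0\<^sub>v (dim_row (stack (r N n) ?As))"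
    show "v = 0\<^sub>v (r N n)"
    proof (rule moment_mat_stack_injective[OF n v])
      fix m i assume mi: "m \<in> {1..n}" "i \<in> {1..N m}"
      then have "moment_mat m n m i \<in> set ?As"
        by (force simp: set_index_pairs)
      then have "moment_mat m n m i *\<^sub>v v = 0\<^sub>v (dim_row (moment_mat m n m i))"
        using stack_kernel[of ?As "r N n" v] dim v 0 by blast
      then show "moment_mat m n m i *\<^sub>v v = 0\<^sub>v (r N (n - m))"
        by (simp add: moment_mat_def)
    qed
  qed
qed

end

lemma orthonormal_imp_system:
  assumes w: "\<And>n. is_monom_vec N n (w n)" and p: "\<And>n. p n \<in> carrier_vec (r N n)"
    and L: "linear L" "\<And>P. P \<in> Sym N \<Longrightarrow> L P = L\<^sub>0 P"
    and ortho: "orthonormal N w L\<^sub>0 p" and basis: "entries_form_basis N p"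
  shows "orthonormal_system N p L"
proof (rule orthonormal_system.intro)
  note dims = is_monom_vecD(1)[OF w] carrier_vecD[OF p]
  show "linear L" by (rule L)
  have p_le: "p n $ j \<in> Sym_le N n" if "j < r N n" for n j
  proof -
    have "p n $ j \<in> set\<^sub>v (p n)" using that by (simp add: vec_setI dims)
    then show ?thesis using ortho by (simp add: orthonormal_def Sym_le_def)
  qed
  then show "j < r N n \<Longrightarrow> p n $ j \<in> Sym_le N n" for n j .
  have p_Sym: "p n $ j \<in> Sym N" if "j < r N n" for n j
    using p_le[OF that] Sym_le_subset_Sym by blast
  have pair: "L (monom_of \<alpha> * p n $ j) = pairing L\<^sub>0 (w m) (p n) $$ (a, j)"
    if "w m $ a = monom_of \<alpha>" "\<alpha> \<in> monoms N" "a < r N m" "j < r N n" for m n a j \<alpha>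
  proof -
    have "monom_of \<alpha> \<in> Sym N" using that(2) by (simp add: Sym_def)
    then have "L (monom_of \<alpha> * p n $ j) = L\<^sub>0 (monom_of \<alpha> * p n $ j)"
      using L(2) Sym_mult p_Sym that(4) by blast
    then show ?thesis using that by (simp add: pairing_def dims)
  qed
  show "L (monom_of \<alpha> * p n $ j) = 0" if \<alpha>: "\<alpha> \<in> monoms N" "mdeg \<alpha> < n" "j < r N n" for n j \<alpha>
  proof -
    obtain a where "a < r N (mdeg \<alpha>)" "w (mdeg \<alpha>) $ a = monom_of \<alpha>"
      using is_monom_vecD(3)[OF w, of \<alpha> "mdeg \<alpha>"] \<alpha>(1) by (auto simp: monoms_of_degree_def)
    moreover have "pairing L\<^sub>0 (w (mdeg \<alpha>)) (p n) = 0\<^sub>m (r N (mdeg \<alpha>)) (r N n)"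
      using ortho \<alpha>(2) by (simp add: orthonormal_def)
    ultimately show ?thesis using pair \<alpha> by simp
  qed
  show "L (p n $ a * p n $ b) = of_bool (a = b)" if "a < r N n" "b < r N n" for n a b
  proof -
    have "L (p n $ a * p n $ b) = pairing L\<^sub>0 (p n) (p n) $$ (a, b)"
      using that by (simp add: pairing_def dims L(2) Sym_mult p_Sym)
    also have "pairing L\<^sub>0 (p n) (p n) = 1\<^sub>m (r N n)" using ortho by (simp add: orthonormal_def)
    finally show ?thesis using that by simp
  qed
  show "Sym N \<subseteq> Real_Vector_Spaces.span {p k $ l | k l. l < r N k}"
  proof -
    have "(\<lambda>(n, j). p n $ j) ` {(n, j). j < dim_vec (p n)} = {p k $ l | k l. l < r N k}"
      by (auto simp: dims)
    then show ?thesis using basis by (simp add: entries_form_basis_def is_basis_Sym_def)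
  qed
  show "c j = 0"
    if c: "\<And>\<alpha>. \<alpha> \<in> monoms_of_degree N n \<Longrightarrow> (\<Sum>l<r N n. c l * L (monom_of \<alpha> * p n $ l)) = 0"
      and j: "j < r N n" for n c j
  proof -
    let ?H = "pairing L\<^sub>0 (w n) (p n)"
    have H: "?H \<in> carrier_mat (r N n) (r N n)" by (simp add: pairing_def dims)
    have v: "vec (r N n) c \<in> carrier_vec (r N n)" by simp
    have rows: "(\<Sum>l<r N n. ?H $$ (a, l) * vec (r N n) c $ l) = 0" if a: "a < r N n" for a
    proof -
      obtain \<alpha> where \<alpha>: "\<alpha> \<in> monoms_of_degree N n" "w n $ a = monom_of \<alpha>"
        using is_monom_vecD(2)[OF w a] by blast
      have "\<alpha> \<in> monoms N" using \<alpha>(1) by (simp add: monoms_of_degree_def)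
      then have "(\<Sum>l<r N n. ?H $$ (a, l) * vec (r N n) c $ l)
          = (\<Sum>l<r N n. c l * L (monom_of \<alpha> * p n $ l))"
        using pair[OF \<alpha>(2) _ a] by (intro sum.cong) simp_all
      then show ?thesis using c[OF \<alpha>(1)] by simp
    qed
    have 0: "?H *\<^sub>v vec (r N n) c = 0\<^sub>v (r N n)"
      unfolding mult_mat_vec_eq_0_iff[OF H carrier_vecD[OF v]] using rows by blast
    have "invertible_mat ?H" using ortho by (simp add: orthonormal_def)
    then obtain B where B: "inverts_mat B ?H" "inverts_mat ?H B"
      unfolding invertible_mat_def by blast
    have "dim_row B = r N n" "dim_col B = r N n"
      using B H unfolding inverts_mat_def
      by (metis carrier_matD(2) index_mult_mat(3) index_one_mat(3),
          metis carrier_matD(1) index_mult_mat(3) index_one_mat(3))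
    then have Bc: "B \<in> carrier_mat (r N n) (r N n)" by (rule carrier_matI)
    have "vec (r N n) c = (B * ?H) *\<^sub>v vec (r N n) c"
      using B(1) Bc v by (simp add: inverts_mat_def)
    also have "\<dots> = B *\<^sub>v (?H *\<^sub>v vec (r N n) c)" by (rule assoc_mult_mat_vec[OF Bc H v])
    also have "\<dots> = 0\<^sub>v (r N n)" unfolding 0 using Bc by (simp add: vec_eq_iff)
    finally have "vec (r N n) c $ j = 0\<^sub>v (r N n) $ j" by simp
    then show ?thesis using j by simp
  qed
qed

section \<open>From the recurrence to orthonormality\<close>

text \<open>A family that spans a subspace containing as many independent vectors as the family has members
  is a basis of the span of these vectors.\<close>

lemma spanning_family_is_basis:
  fixes f :: "'i \<Rightarrow> 'v::real_vector"
  assumes I: "finite I" and S: "finite S" "\<not> Real_Vector_Spaces.dependent S" "card S = card I"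
    and sub: "S \<subseteq> Real_Vector_Spaces.span (f ` I)"
  shows "inj_on f I" "\<not> Real_Vector_Spaces.dependent (f ` I)"
    "Real_Vector_Spaces.span (f ` I) = Real_Vector_Spaces.span S"
proof -
  let ?T = "f ` I"
  have T: "finite ?T" using I by simp
  have bound: "card A \<le> card B"
    if "finite B" "\<not> Real_Vector_Spaces.dependent A" "A \<subseteq> Real_Vector_Spaces.span B" for A B :: "'v set"
    using real_vector.independent_span_bound[OF that] by simp
  have card_T: "card ?T = card I"
    using bound[OF T S(2) sub] card_image_le[OF I, of f] S(3) by simp
  then show "inj_on f I" using I by (simp add: eq_card_imp_inj_on)
  show "\<not> Real_Vector_Spaces.dependent ?T"
  proof
    assume "Real_Vector_Spaces.dependent ?T"
    then obtain t where t: "t \<in> ?T" "t \<in> Real_Vector_Spaces.span (?T - {t})"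
      by (auto simp: real_vector.dependent_def)
    then have "Real_Vector_Spaces.span (?T - {t}) = Real_Vector_Spaces.span ?T"
      by (metis insert_Diff real_vector.span_redundant)
    then have "card S \<le> card (?T - {t})" using bound[of "?T - {t}" S] T S sub by simp
    then show False using t(1) T card_T S(3) card_Diff1_less[OF T t(1)] by linarith
  qed
  have "?T \<subseteq> Real_Vector_Spaces.span S"
  proof (rule ccontr)
    assume "\<not> ?T \<subseteq> Real_Vector_Spaces.span S"
    then obtain t where t: "t \<in> ?T" "t \<notin> Real_Vector_Spaces.span S" by blast
    then have "\<not> Real_Vector_Spaces.dependent (insert t S)"
      using real_vector.independent_insertI S(2) by blast
    moreover have "insert t S \<subseteq> Real_Vector_Spaces.span ?T"
      using t(1) sub real_vector.span_base by blast
    ultimately have "card (insert t S) \<le> card ?T" by (rule bound[OF T])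
    moreover have "t \<notin> S" using t(2) real_vector.span_base by blast
    ultimately show False using S card_T by simp
  qed
  then show "Real_Vector_Spaces.span ?T = Real_Vector_Spaces.span S"
    using sub by (simp add: real_vector.span_eq)
qed

text \<open>A sequence that starts with \<open>p\<^sub>0 = 1\<close> and satisfies the recurrence, written entry by entry.\<close>

locale recurrent_system =
  fixes N :: "nat \<Rightarrow> nat" and p :: "nat \<Rightarrow> gpoly vec"
    and M :: "nat \<Rightarrow> nat \<Rightarrow> nat \<Rightarrow> nat \<Rightarrow> real mat"
  assumes p_0: "p 0 $ 0 = 1"
    and recurrence: "\<And>m i a j. \<lbrakk>1 \<le> m; i \<in> {1..N m}; j < r N a\<rbrakk> \<Longrightarrow>
      indet m i * p a $ j = (\<Sum>b\<le>a + m. \<Sum>l<r N b. rec_coeff M m i a b j l *\<^sub>R p b $ l)"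
begin

text \<open>The entries of all \<open>p n\<close> as one family, and the indices \<open>(k, j)\<close> of the entries with \<open>k \<le> n\<close>.\<close>

definition entry :: "nat \<times> nat \<Rightarrow> gpoly" where "entry = (\<lambda>(k, j). p k $ j)"

definition positions :: "nat \<Rightarrow> (nat \<times> nat) set" where "positions n = (SIGMA k:{..n}. {..<r N k})"

lemma entry_in_span: "k \<le> n \<Longrightarrow> j < r N k \<Longrightarrow> p k $ j \<in> Real_Vector_Spaces.span (entry ` positions n)"
  by (rule real_vector.span_base) (force simp: entry_def positions_def)

text \<open>The recurrence expresses \<open>w\<^sub>m\<^sub>,\<^sub>i p\<^sub>k\<close> through \<open>p\<^sub>b\<close> with \<open>b \<le> k + m\<close>, so all monomials are reached from \<open>p 0 = 1\<close>.\<close>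

lemma monom_in_span:
  "\<lbrakk>\<alpha> \<in> monoms N; mdeg \<alpha> \<le> n\<rbrakk> \<Longrightarrow> monom_of \<alpha> \<in> Real_Vector_Spaces.span (entry ` positions n)"
proof (induction "mdeg \<alpha>" arbitrary: \<alpha> n rule: less_induct)
  case less
  show ?case using less.prems(1)
  proof (cases rule: monom_cases)
    case 1
    then show ?thesis using entry_in_span[of 0 n 0] p_0 r_0[of N] by simp
  next
    case (2 m i \<beta>)
    let ?W = "(\<lambda>Q. indet m i * Q) -` Real_Vector_Spaces.span (entry ` positions n)"
    have W: "Real_Vector_Spaces.subspace ?W"
      by (rule linear_subspace_vimage[OF linear_mult_left real_vector.subspace_span])
    have "indet m i * p k $ j \<in> Real_Vector_Spaces.span (entry ` positions n)"
      if "k \<le> n - m" "j < r N k" for k j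
      unfolding recurrence[OF 2(1,2) that(2)] using that(1) 2(5) less.prems(2)
      by (intro real_vector.span_sum real_vector.span_scale entry_in_span) auto
    then have "entry ` positions (n - m) \<subseteq> ?W"
      by (auto simp: entry_def positions_def)
    moreover have "monom_of \<beta> \<in> Real_Vector_Spaces.span (entry ` positions (n - m))"
      using less.hyps[of \<beta> "n - m"] 2 less.prems(2) by simp
    ultimately have "monom_of \<beta> \<in> ?W" using real_vector.span_minimal[OF _ W] by blast
    then show ?thesis by (simp add: 2(6))
  qed
qed

lemma card_positions: "card (positions n) = (\<Sum>k\<le>n. r N k)"
  by (simp add: positions_def)

text \<open>The entries of \<open>p\<^sub>0, \<dots>, p\<^sub>n\<close> are as many as the monomials of degree at most \<open>n\<close>, which they span; a
  dimension count makes them a basis and bounds their degrees.\<close>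

lemma
  shows inj_entry_le: "inj_on entry (positions n)"
    and independent_entry_le: "\<not> Real_Vector_Spaces.dependent (entry ` positions n)"
    and span_entry_le: "Real_Vector_Spaces.span (entry ` positions n) = Sym_le N n"
proof -
  let ?A = "{\<alpha> \<in> monoms N. mdeg \<alpha> \<le> n}"
  have card: "card (monom_of ` ?A) = card (positions n)"
    by (subst card_image) (simp_all add: inj_on_def card_monoms_le card_positions)
  have fin: "finite (monom_of ` ?A)"
    unfolding monoms_le_eq by (simp add: finite_monoms_of_degree)
  have sub: "monom_of ` ?A \<subseteq> Real_Vector_Spaces.span (entry ` positions n)"
    using monom_in_span by auto
  have "finite (positions n)" by (simp add: positions_def)
  note * = spanning_family_is_basis[OF this fin independent_monom_of card sub]
  from * show "inj_on entry (positions n)" "\<not> Real_Vector_Spaces.dependent (entry ` positions n)" by blast+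
  from *(3) show "Real_Vector_Spaces.span (entry ` positions n) = Sym_le N n"
    by (simp add: span_monom_of Sym_le_eq)
qed

lemma entry_Sym_le: "j < r N n \<Longrightarrow> p n $ j \<in> Sym_le N n"
  using entry_in_span[of n n j] by (simp add: span_entry_le)

text \<open>The indices of all entries.\<close>

definition all_positions :: "(nat \<times> nat) set" where "all_positions = (SIGMA k:UNIV. {..<r N k})"

lemma positions_mono: "m \<le> n \<Longrightarrow> positions m \<subseteq> positions n"
  by (auto simp: positions_def)

lemma all_positions_eq: "all_positions = (\<Union>n. positions n)"
  by (auto simp: positions_def all_positions_def)

lemma inj_entry: "inj_on entry all_positions"
proof (rule inj_onI)
  fix x y assume "x \<in> all_positions" "y \<in> all_positions" and eq: "entry x = entry y"
  then obtain m n where "x \<in> positions m" "y \<in> positions n" by (auto simp: all_positions_eq)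
  then have "x \<in> positions (max m n)" "y \<in> positions (max m n)"
    using positions_mono[of m "max m n"] positions_mono[of n "max m n"] by auto
  then show "x = y" using eq inj_entry_le[of "max m n"] by (meson inj_onD)
qed

lemma independent_entry: "\<not> Real_Vector_Spaces.dependent (entry ` all_positions)"
proof -
  have "entry ` all_positions = \<Union> (range (\<lambda>n. entry ` positions n))"
    by (auto simp: all_positions_eq)
  moreover have "\<not> Real_Vector_Spaces.dependent (\<Union> (range (\<lambda>n. entry ` positions n)))"
  proof (rule real_vector.independent_Union_directed)
    fix c d assume "c \<in> range (\<lambda>n. entry ` positions n)" "d \<in> range (\<lambda>n. entry ` positions n)"
    then obtain m n where "c = entry ` positions m" "d = entry ` positions n" by blast
    then show "c \<subseteq> d \<or> d \<subseteq> c"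
      using positions_mono[of m n] positions_mono[of n m] by (meson image_mono nle_le)
  qed (auto simp: independent_entry_le)
  ultimately show ?thesis by simp
qed

lemma span_entry: "Real_Vector_Spaces.span (entry ` all_positions) = Sym N"
proof
  have "p k $ j \<in> Sym N" if "j < r N k" for k j
    using entry_Sym_le[OF that] Sym_le_subset_Sym by blast
  then have "entry ` all_positions \<subseteq> Sym N" by (auto simp: all_positions_def entry_def)
  then show "Real_Vector_Spaces.span (entry ` all_positions) \<subseteq> Sym N"
    by (rule real_vector.span_minimal[OF _ subspace_Sym])
  show "Sym N \<subseteq> Real_Vector_Spaces.span (entry ` all_positions)"
  proof
    fix P assume "P \<in> Sym N"
    then obtain n where "P \<in> Sym_le N n" by (rule Sym_obtain_le)
    then have "P \<in> Real_Vector_Spaces.span (entry ` positions n)" by (simp add: span_entry_le)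
    moreover have "entry ` positions n \<subseteq> entry ` all_positions" by (auto simp: all_positions_eq)
    ultimately show "P \<in> Real_Vector_Spaces.span (entry ` all_positions)"
      by (meson real_vector.span_mono subsetD)
  qed
qed

lemma recurrent_entries_form_basis:
  assumes "\<And>n. p n \<in> carrier_vec (r N n)"
  shows "entries_form_basis N p"
proof -
  have "{(n, j). j < dim_vec (p n)} = all_positions"
    using carrier_vecD[OF assms] by (auto simp: all_positions_def)
  then show ?thesis
    using inj_entry independent_entry span_entry real_vector.span_superset[of "entry ` all_positions"]
    unfolding entries_form_basis_def is_basis_Sym_def entry_def[symmetric] by simp
qed

lemma coordinate_functionals:
  "\<exists>\<phi> :: nat \<Rightarrow> nat \<Rightarrow> gpoly \<Rightarrow> real. (\<forall>n j. linear (\<phi> n j)) \<and>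
    (\<forall>n j k l. j < r N n \<longrightarrow> l < r N k \<longrightarrow> \<phi> n j (p k $ l) = of_bool (k = n \<and> l = j))"
proof -
  have "\<exists>g. linear g \<and> (\<forall>x\<in>entry ` all_positions. g x = (of_bool (x = entry (n, j)) :: real))" for n j
    by (rule linear_independent_extend[OF independent_entry])
  then obtain \<phi> where \<phi>: "\<And>n j. linear (\<phi> n j)"
      "\<And>n j x. x \<in> entry ` all_positions \<Longrightarrow> \<phi> n j x = (of_bool (x = entry (n, j)) :: real)"
    by metis
  have "\<phi> n j (p k $ l) = of_bool (k = n \<and> l = j)" if "j < r N n" "l < r N k" for n j k l
  proof -
    have "(k, l) \<in> all_positions" "(n, j) \<in> all_positions" using that by (auto simp: all_positions_def)
    then have "\<phi> n j (entry (k, l)) = of_bool ((k, l) = (n, j))"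
      using \<phi>(2) inj_entry by (auto simp: inj_on_eq_iff)
    then show ?thesis by (simp add: entry_def)
  qed
  then show ?thesis using \<phi>(1) by blast
qed

lemma linear_eq_on_Sym_le:
  fixes f g :: "gpoly \<Rightarrow> real"
  assumes "linear f" "linear g" "P \<in> Sym_le N n"
    "\<And>k j. \<lbrakk>k \<le> n; j < r N k\<rbrakk> \<Longrightarrow> f (p k $ j) = g (p k $ j)"
  shows "f P = g P"
proof (rule linear_eq_on[OF assms(1,2)])
  show "P \<in> Real_Vector_Spaces.span (entry ` positions n)" using assms(3) by (simp add: span_entry_le)
qed (use assms(4) in \<open>auto simp: entry_def positions_def\<close>)

lemma recurrence_functional:
  assumes "linear f" "1 \<le> m" "i \<in> {1..N m}" "j < r N a"
  shows "f (Q * (indet m i * p a $ j)) =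
    (\<Sum>b\<le>a + m. \<Sum>l<r N b. rec_coeff M m i a b j l * (f (Q * p b $ l) :: real))"
  unfolding recurrence[OF assms(2-4)]
  by (simp add: sum_distrib_left linear_sum[OF assms(1)] linear_scale[OF assms(1)])

end

text \<open>The functional \<open>\<phi> n j\<close> reads off the coefficient of \<open>p n $ j\<close>. The one that belongs to
  \<open>p 0 $ 0 = 1\<close> is the only candidate for the functional \<open>L\<close>, since an
  orthonormal sequence has \<open>L (p n $ j) = L (p n $ j * 1) = 0\<close> for \<open>n \<ge> 1\<close>.\<close>

locale coordinate_system = recurrent_system +
  fixes \<phi> :: "nat \<Rightarrow> nat \<Rightarrow> gpoly \<Rightarrow> real"
  assumes \<phi>_linear: "\<And>n j. linear (\<phi> n j)"
    and \<phi>_entry: "\<And>n j k l. \<lbrakk>j < r N n; l < r N k\<rbrakk> \<Longrightarrow> \<phi> n j (p k $ l) = of_bool (k = n \<and> l = j)"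
begin

definition L :: "gpoly \<Rightarrow> real" where "L = \<phi> 0 0"

lemma L_entry: "l < r N k \<Longrightarrow> L (p k $ l) = of_bool (k = 0 \<and> l = 0)"
  using \<phi>_entry[of 0 0 l k] by (simp add: L_def r_0)

lemma L_linear: "linear L"
  by (simp add: L_def \<phi>_linear)

text \<open>Each factor \<open>w\<^sub>m\<^sub>,\<^sub>i\<close> of a monomial lowers the index \<open>b\<close> of \<open>p\<^sub>b\<close> by at most \<open>m\<close>, so multiplication of
  \<open>p\<^sub>b\<close> by a monomial of degree less than \<open>b\<close> never reaches \<open>p\<^sub>0\<close>.\<close>

lemma L_monom_entry_eq_0:
  "\<lbrakk>\<alpha> \<in> monoms N; mdeg \<alpha> < b; l < r N b\<rbrakk> \<Longrightarrow> L (monom_of \<alpha> * p b $ l) = 0"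
proof (induction "mdeg \<alpha>" arbitrary: \<alpha> b l rule: less_induct)
  case less
  show ?case using less.prems(1)
  proof (cases rule: monom_cases)
    case 1
    then show ?thesis using less.prems L_entry by simp
  next
    case (2 m i \<beta>)
    have "L (monom_of \<alpha> * p b $ l) = L (monom_of \<beta> * (indet m i * p b $ l))"
      by (simp add: 2(6) mult_ac)
    also have "\<dots> = (\<Sum>b'\<le>b + m. \<Sum>l'<r N b'. rec_coeff M m i b b' l l' * L (monom_of \<beta> * p b' $ l'))"
      by (rule recurrence_functional[OF L_linear 2(1,2) less.prems(3)])
    also have "\<dots> = 0"
    proof (intro sum.neutral ballI)
      fix b' l' assume "l' \<in> {..<r N b'}"
      then show "rec_coeff M m i b b' l l' * L (monom_of \<beta> * p b' $ l') = 0"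
        using less.hyps[of \<beta> b' l'] less.prems(2) 2(1,3,5)
        by (cases "mdeg \<beta> < b'") (auto simp: rec_coeff_def)
    qed
    finally show ?thesis .
  qed
qed

lemma L_Sym_le_entry_eq_0:
  assumes "P \<in> Sym_le N m" "m < n" "l < r N n"
  shows "L (P * p n $ l) = 0"
proof (rule linear_eq_0_on_keys[where f = "\<lambda>P. L (P * p n $ l)"])
  show "linear (\<lambda>P. L (P * p n $ l))"
    using linear_compose[OF linear_mult_right L_linear] by (simp add: o_def)
  show "Poly_Mapping.keys P \<subseteq> {\<alpha> \<in> monoms N. mdeg \<alpha> \<le> m}" using assms(1) by (simp add: Sym_le_eq)
qed (use L_monom_entry_eq_0 assms in auto)

lemma \<phi>_Sym_le_eq_0:
  assumes "P \<in> Sym_le N m" "m < n" "l < r N n"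
  shows "\<phi> n l P = 0"
  using linear_eq_on_Sym_le[OF \<phi>_linear linear_zero assms(1), of n l] \<phi>_entry assms by auto

text \<open>Multiplication by \<open>w\<^sub>m\<^sub>,\<^sub>i\<close> raises the index by at most \<open>m\<close>. So for \<open>P\<close> of degree at most \<open>d\<close> the
  coefficients of \<open>w\<^sub>m\<^sub>,\<^sub>i P\<close> at the index \<open>d + m\<close> depend only on those of \<open>P\<close> at \<open>d\<close>, through the matrix \<open>A\<^bsub>d+m,m,i\<^esub>\<close>.\<close>

lemma \<phi>_indet_mult:
  assumes m: "1 \<le> m" and i: "i \<in> {1..N m}" and l: "l < r N (d + m)" and P: "P \<in> Sym_le N d"
  shows "\<phi> (d + m) l (indet m i * P) = (\<Sum>j<r N d. M m (d + m) m i $$ (j, l) * \<phi> d j P)"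
proof (rule linear_eq_on_Sym_le[OF _ _ P])
  show "linear (\<lambda>P. \<phi> (d + m) l (indet m i * P))"
    using linear_compose[OF linear_mult_left \<phi>_linear] by (simp add: o_def)
  show "linear (\<lambda>P. \<Sum>j<r N d. M m (d + m) m i $$ (j, l) * \<phi> d j P)"
    by (intro linear_compose_sum ballI linear_compose[OF \<phi>_linear, unfolded o_def]
        bounded_linear.linear bounded_linear_mult_right)
  fix k j assume k: "k \<le> d" "j < r N k"
  have "\<phi> (d + m) l (indet m i * p k $ j)
      = (\<Sum>b\<le>k + m. \<Sum>l'<r N b. rec_coeff M m i k b j l' * \<phi> (d + m) l (p b $ l'))"
    using recurrence_functional[OF \<phi>_linear m i k(2), of "d + m" l 1] by simp
  also have "\<dots> = (\<Sum>b\<le>k + m. if b = d + m then rec_coeff M m i k b j l else 0)"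
  proof (rule sum.cong[OF refl])
    fix b
    have "(\<Sum>l'<r N b. rec_coeff M m i k b j l' * \<phi> (d + m) l (p b $ l'))
        = (\<Sum>l'<r N b. if l' = l then (if b = d + m then rec_coeff M m i k b j l else 0) else 0)"
      by (rule sum.cong) (auto simp: \<phi>_entry l)
    then show "(\<Sum>l'<r N b. rec_coeff M m i k b j l' * \<phi> (d + m) l (p b $ l'))
        = (if b = d + m then rec_coeff M m i k b j l else 0)"
      using l by auto
  qed
  also have "\<dots> = (if k = d then M m (d + m) m i $$ (j, l) else 0)"
    using k by (auto simp: rec_coeff_def)
  also have "\<dots> = (\<Sum>j'<r N d. if j' = j then (if k = d then M m (d + m) m i $$ (j, l) else 0) else 0)"
    using k by auto
  also have "\<dots> = (\<Sum>j'<r N d. M m (d + m) m i $$ (j', l) * \<phi> d j' (p k $ j))"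
    using k by (intro sum.cong) (auto simp: \<phi>_entry)
  finally show "\<phi> (d + m) l (indet m i * p k $ j)
      = (\<Sum>j'<r N d. M m (d + m) m i $$ (j', l) * \<phi> d j' (p k $ j))" .
qed

text \<open>Pairing with \<open>p\<^sub>n\<close> and taking coefficients at \<open>p\<^sub>n\<close> agree in degree \<open>n\<close>: by the lemma above, the
  coefficients go up from degree \<open>n - m\<close> to \<open>n\<close> through \<open>A\<^sub>n\<^sub>,\<^sub>m\<^sub>,\<^sub>i\<close>, while \<open>w\<^sub>m\<^sub>,\<^sub>i p\<^sub>n\<close> involves \<open>p\<^sub>n\<^sub>-\<^sub>m\<close> through
  the transpose of the same matrix.\<close>

lemma L_monom_entry:
  "\<lbrakk>\<alpha> \<in> monoms N; mdeg \<alpha> = n; l < r N n\<rbrakk> \<Longrightarrow> L (monom_of \<alpha> * p n $ l) = \<phi> n l (monom_of \<alpha>)"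
proof (induction "mdeg \<alpha>" arbitrary: \<alpha> n l rule: less_induct)
  case less
  show ?case using less.prems(1)
  proof (cases rule: monom_cases)
    case 1
    then have "n = 0" "l = 0" using less.prems r_0[of N] by auto
    then show ?thesis using 1 \<phi>_entry[of 0 0 0 0] L_entry[of 0 0] p_0 r_0[of N] by simp
  next
    case (2 m i \<beta>)
    define d where "d = mdeg \<beta>"
    have n: "n = d + m" using 2 less.prems by (simp add: d_def)
    have IH: "L (monom_of \<beta> * p d $ j) = \<phi> d j (monom_of \<beta>)" if "j < r N d" for j
    proof (rule less.hyps[OF _ 2(3) _ that])
      show "mdeg \<beta> < mdeg \<alpha>" using 2(1,5) by linarith
      show "mdeg \<beta> = d" by (simp add: d_def)
    qed
    have "L (monom_of \<alpha> * p n $ l) = L (monom_of \<beta> * (indet m i * p n $ l))"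
      by (simp add: 2(6) mult_ac)
    also have "\<dots> = (\<Sum>b\<le>n + m. \<Sum>j<r N b. rec_coeff M m i n b l j * L (monom_of \<beta> * p b $ j))"
      by (rule recurrence_functional[OF L_linear 2(1,2) less.prems(3)])
    also have "\<dots> = (\<Sum>b\<in>{d}. \<Sum>j<r N b. rec_coeff M m i n b l j * L (monom_of \<beta> * p b $ j))"
    proof (intro sum.mono_neutral_right ballI sum.neutral)
      \<comment> \<open>Indices above \<open>d\<close> die by orthogonality, those below \<open>d = n - m\<close> do not occur in the recurrence.\<close>
      fix b j assume "b \<in> {..n + m} - {d}" "j \<in> {..<r N b}"
      then show "rec_coeff M m i n b l j * L (monom_of \<beta> * p b $ j) = 0"
        using L_monom_entry_eq_0[of \<beta> b j] 2(3)
        by (cases "d < b") (auto simp: rec_coeff_def n d_def)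
    qed (auto simp: n)
    also have "\<dots> = (\<Sum>j<r N d. M m (d + m) m i $$ (j, l) * \<phi> d j (monom_of \<beta>))"
      using 2(1) by (auto simp: IH rec_coeff_def n)
    also have "\<dots> = \<phi> n l (monom_of \<alpha>)"
      using \<phi>_indet_mult[OF 2(1,2), of l d "monom_of \<beta>"] less.prems(3) 2(3)
      by (simp add: n 2(6) monom_of_in_Sym_le d_def)
    finally show ?thesis .
  qed
qed

lemma L_coordinate:
  assumes P: "P \<in> Sym_le N n" and l: "l < r N n"
  shows "L (P * p n $ l) = \<phi> n l P"
proof (rule linear_eq_on[where f = "\<lambda>P. L (P * p n $ l)" and g = "\<phi> n l"])
  show "linear (\<lambda>P. L (P * p n $ l))"
    using linear_compose[OF linear_mult_right L_linear] by (simp add: o_def)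
  show "linear (\<phi> n l)" by (rule \<phi>_linear)
  show "P \<in> Real_Vector_Spaces.span (monom_of ` {\<alpha> \<in> monoms N. mdeg \<alpha> \<le> n})"
    using P by (simp add: span_monom_of Sym_le_eq)
  fix Q assume "Q \<in> monom_of ` {\<alpha> \<in> monoms N. mdeg \<alpha> \<le> n}"
  then obtain \<alpha> where Q: "Q = monom_of \<alpha>" "\<alpha> \<in> monoms N" "mdeg \<alpha> \<le> n" by blast
  show "L (Q * p n $ l) = \<phi> n l Q"
  proof (cases "mdeg \<alpha> = n")
    case False
    then have "Q \<in> Sym_le N (mdeg \<alpha>)" "mdeg \<alpha> < n" using Q by (simp_all add: monom_of_in_Sym_le)
    then show ?thesis using L_Sym_le_entry_eq_0 \<phi>_Sym_le_eq_0 l by simp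
  qed (use L_monom_entry Q l in simp)
qed

lemma L_entry_entry:
  assumes "j < r N n" "l < r N k"
  shows "L (p n $ j * p k $ l) = of_bool (n = k \<and> j = l)"
proof -
  consider "n < k" | "k < n" | "n = k" by linarith
  then show ?thesis
  proof cases
    case 1
    then show ?thesis using L_Sym_le_entry_eq_0[OF entry_Sym_le] assms by simp
  next
    case 2
    then show ?thesis
      using L_Sym_le_entry_eq_0[OF entry_Sym_le, of l k n j] assms by (simp add: mult.commute)
  next
    case 3
    then show ?thesis using L_coordinate[OF entry_Sym_le] \<phi>_entry assms by simp
  qed
qed

lemma positive_definite_L: "positive_definite N L"
  unfolding positive_definite_def
proof (intro conjI exI)
  show "linear_functional N L"
    by (simp add: linear_functional_def linear_add[OF L_linear] linear_scale[OF L_linear])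
  show "is_basis_Sym N (entry ` all_positions)"
    unfolding is_basis_Sym_def
    using independent_entry span_entry real_vector.span_superset[of "entry ` all_positions"] by simp
  show "\<forall>P\<in>entry ` all_positions. \<forall>Q\<in>entry ` all_positions. P \<noteq> Q \<longrightarrow> L (P * Q) = 0"
    by (auto simp: all_positions_def entry_def L_entry_entry)
  show "\<forall>P\<in>entry ` all_positions. L (P * P) > 0"
    by (auto simp: all_positions_def entry_def L_entry_entry)
qed

lemma orthonormal_L:
  assumes w: "\<And>n. is_monom_vec N n (w n)" and p: "\<And>n. p n \<in> carrier_vec (r N n)"
  shows "orthonormal N w L p"
  unfolding orthonormal_def
proof (intro allI conjI ballI impI)
  fix n
  note dims = is_monom_vecD(1)[OF w] carrier_vecD[OF p]
  show "p n \<in> carrier_vec (r N n)" by (rule p)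
  {
    fix P assume "P \<in> set\<^sub>v (p n)"
    then obtain j where "j < r N n" "P = p n $ j" by (auto simp: vec_set_def dims)
    then have "P \<in> Sym_le N n" using entry_Sym_le by blast
    then show "P \<in> Sym N" "total_degree_le P n" by (auto simp: Sym_le_def)
  }
  show "pairing L (w m) (p n) = 0\<^sub>m (r N m) (r N n)" if "m < n" for m
  proof (rule eq_matI)
    fix a l assume al: "a < dim_row (0\<^sub>m (r N m) (r N n) :: real mat)"
      "l < dim_col (0\<^sub>m (r N m) (r N n) :: real mat)"
    then obtain \<alpha> where "\<alpha> \<in> monoms_of_degree N m" "w m $ a = monom_of \<alpha>"
      using is_monom_vecD(2)[OF w] by fastforce
    then show "pairing L (w m) (p n) $$ (a, l) = 0\<^sub>m (r N m) (r N n) $$ (a, l)"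
      using al that by (simp add: pairing_def dims L_monom_entry_eq_0 monoms_of_degree_def)
  qed (simp_all add: pairing_def dims)
  show "pairing L (p n) (p n) = 1\<^sub>m (r N n)"
    by (rule eq_matI) (simp_all add: pairing_def dims L_entry_entry)
  let ?H = "pairing L (w n) (p n)"
  have H: "?H \<in> carrier_mat (r N n) (r N n)" by (simp add: pairing_def dims)
  \<comment> \<open>A vector \<open>v\<close> in the kernel of \<open>?H\<close> gives a combination of the entries of \<open>p n\<close> that is orthogonal to all
      polynomials of degree at most \<open>n\<close>, in particular to each entry of \<open>p n\<close>.\<close>
  have "v = 0\<^sub>v (r N n)" if v: "v \<in> carrier_vec (r N n)" and 0: "?H *\<^sub>v v = 0\<^sub>v (r N n)" for v
  proof -
    have rows: "(\<Sum>l<r N n. L (w n $ a * p n $ l) * v $ l) = 0" if "a < r N n" for a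
    proof -
      have "(\<Sum>l<r N n. ?H $$ (a, l) * v $ l) = 0"
        using 0 that carrier_vecD[OF v] by (simp add: mult_mat_vec_eq_0_iff[OF H])
      then show ?thesis using that by (simp add: pairing_def dims)
    qed
    define f where "f P = (\<Sum>l<r N n. L (P * p n $ l) * v $ l)" for P
    have f: "linear f"
      unfolding f_def
      by (rule linearI) (simp_all add: distrib_right linear_add[OF L_linear]
          linear_scale[OF L_linear] sum.distrib sum_distrib_left mult.assoc)
    have "f (monom_of \<alpha>) = 0" if \<alpha>: "\<alpha> \<in> monoms N" "mdeg \<alpha> \<le> n" for \<alpha>
    proof (cases "mdeg \<alpha> = n")
      case True
      then obtain a where "a < r N n" "w n $ a = monom_of \<alpha>"
        using is_monom_vecD(3)[OF w, of \<alpha> n] \<alpha> by (auto simp: monoms_of_degree_def)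
      then show ?thesis using rows[of a] by (simp add: f_def)
    next
      case False
      then show ?thesis using \<alpha> L_monom_entry_eq_0 by (simp add: f_def)
    qed
    then have f0: "f P = 0" if "P \<in> Sym_le N n" for P
      using linear_eq_0_on_keys[OF f, of P "{\<alpha> \<in> monoms N. mdeg \<alpha> \<le> n}"] that by (auto simp: Sym_le_eq)
    have "v $ j = 0" if j: "j < r N n" for j
    proof -
      have "f (p n $ j) = (\<Sum>l<r N n. if l = j then v $ l else 0)"
        unfolding f_def using j by (intro sum.cong) (auto simp: L_entry_entry)
      then show ?thesis using f0[OF entry_Sym_le[OF j]] j by simp
    qed
    then show ?thesis using v by auto
  qed
  then have "det ?H \<noteq> 0" using det_0_iff_vec_prod_zero_field[OF H] by blast
  then have "?H \<in> Units (ring_mat TYPE(real) (r N n) ())" by (rule det_non_zero_imp_unit[OF H])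
  then obtain B where "B \<in> carrier_mat (r N n) (r N n)" "?H * B = 1\<^sub>m (r N n)" "B * ?H = 1\<^sub>m (r N n)"
    by (auto simp: Units_def ring_mat_def)
  then show "invertible_mat ?H"
    using H unfolding invertible_mat_def inverts_mat_def square_mat.simps by (metis carrier_matD)
qed

end

section \<open>The equivalence\<close>

theorem theorem3p8:
  fixes N :: "nat \<Rightarrow> nat"
    and w :: "nat \<Rightarrow> gpoly vec"
    and p :: "nat \<Rightarrow> gpoly vec"
  assumes w: "\<And>n. is_monom_vec N n (w n)"
    and p_dim: "\<And>n. p n \<in> carrier_vec (r N n)"
    and p_Sym: "\<And>n. set\<^sub>v (p n) \<subseteq> Sym N"
    and p_0: "p 0 = vec_of_list [1]"
  shows
    "(\<exists>L. positive_definite N L \<and> orthonormal N w L p \<and> entries_form_basis N p)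
     \<longleftrightarrow>
     (\<exists>M :: nat \<Rightarrow> nat \<Rightarrow> nat \<Rightarrow> nat \<Rightarrow> real mat.
        (\<forall>n. \<forall>m\<in>{1..n}. \<forall>i\<in>{1..N m}. \<forall>k\<in>{0..m}.
            M k n m i \<in> carrier_mat (r N (n - m)) (r N (n - m + k))) \<and>
        (\<forall>n. \<forall>m\<in>{1..n}. \<forall>i\<in>{1..N m}.
            indet m i \<cdot>\<^sub>v p (n - m) =
              finsum_vec TYPE(gpoly) (r N (n - m))
                (\<lambda>k. mat_act (M k n m i) (p (n - m + k))) {0..m} +
              finsum_vec TYPE(gpoly) (r N (n - m))
                (\<lambda>k. mat_act (transpose_mat (M k (n - k) m i)) (p (n - m - k)))
                {k \<in> {1..m}. m + k \<le> n}) \<and>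
        (let A = (\<lambda>n m i. M m n m i);
             C = (\<lambda>n m i. transpose_mat (M m n m i))
         in \<forall>n\<ge>1.
              (\<forall>m\<in>{1..n}. \<forall>i\<in>{1..N m}.
                  mat_rank (A n m i) = r N (n - m) \<and> mat_rank (C n m i) = r N (n - m)) \<and>
              mat_rank (stack (r N n) (map (\<lambda>(m, i). A n m i) (index_pairs N n))) = r N n \<and>
              mat_rank (stack (r N n)
                (map (\<lambda>(m, i). transpose_mat (C n m i)) (index_pairs N n))) = r N n))"
proof (standard, goal_cases)
  case 1
  then obtain L\<^sub>0 where L\<^sub>0: "positive_definite N L\<^sub>0" "orthonormal N w L\<^sub>0 p" "entries_form_basis N p"
    by blast
  obtain L where L: "linear L" "\<And>P. P \<in> Sym N \<Longrightarrow> L P = L\<^sub>0 P"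
    using linear_functional_extend[OF L\<^sub>0(1)] by blast
  interpret orthonormal_system N p L
    by (rule orthonormal_imp_system[OF w p_dim L L\<^sub>0(2,3)])
  show ?case
    unfolding Let_def transpose_transpose
  proof (intro exI[of _ moment_mat] conjI allI ballI impI)
    fix n m i
    assume mi: "m \<in> {1..n}" "i \<in> {1..N m}"
    show "moment_mat k n m i \<in> carrier_mat (r N (n - m)) (r N (n - m + k))" for k
      by (rule moment_mat_carrier)
    have "indet m i * p (n - m) $ j =
        (\<Sum>b\<le>n. \<Sum>l<r N b. rec_coeff moment_mat m i (n - m) b j l *\<^sub>R p b $ l)"
      if "j < r N (n - m)" for j
      using recurrence_moment_mat[OF _ mi(2) that] mi(1) by simp
    then show "indet m i \<cdot>\<^sub>v p (n - m) =
        finsum_vec TYPE(gpoly) (r N (n - m))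
          (\<lambda>k. mat_act (moment_mat k n m i) (p (n - m + k))) {0..m} +
        finsum_vec TYPE(gpoly) (r N (n - m))
          (\<lambda>k. mat_act (transpose_mat (moment_mat k (n - k) m i)) (p (n - m - k)))
          {k \<in> {1..m}. m + k \<le> n}"
      by (subst vector_recurrence_iff[OF p_dim moment_mat_carrier mi]) blast
  qed (use moment_mat_ranks in blast)+
next
  case 2
  then obtain M where
    M: "\<And>n m i k. \<lbrakk>m \<in> {1..n}; i \<in> {1..N m}; k \<in> {0..m}\<rbrakk> \<Longrightarrow>
        M k n m i \<in> carrier_mat (r N (n - m)) (r N (n - m + k))"
    and rec: "\<And>n m i. \<lbrakk>m \<in> {1..n}; i \<in> {1..N m}\<rbrakk> \<Longrightarrow>
        indet m i \<cdot>\<^sub>v p (n - m) =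
          finsum_vec TYPE(gpoly) (r N (n - m))
            (\<lambda>k. mat_act (M k n m i) (p (n - m + k))) {0..m} +
          finsum_vec TYPE(gpoly) (r N (n - m))
            (\<lambda>k. mat_act (transpose_mat (M k (n - k) m i)) (p (n - m - k)))
            {k \<in> {1..m}. m + k \<le> n}"
    by blast
  interpret recurrent_system N p M
  proof
    show "p 0 $ 0 = 1" by (simp add: p_0)
    fix m i a j
    assume mi: "1 \<le> m" "i \<in> {1..N m}" and j: "j < r N a"
    have m: "m \<in> {1..a + m}" using mi by simp
    show "indet m i * p a $ j = (\<Sum>b\<le>a + m. \<Sum>l<r N b. rec_coeff M m i a b j l *\<^sub>R p b $ l)"
      using vector_recurrence_iff[where M = M, OF p_dim M m mi(2)] rec[OF m mi(2)] j by simp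
  qed
  obtain \<phi> :: "nat \<Rightarrow> nat \<Rightarrow> gpoly \<Rightarrow> real" where \<phi>: "\<And>n j. linear (\<phi> n j)"
    "\<And>n j k l. \<lbrakk>j < r N n; l < r N k\<rbrakk> \<Longrightarrow> \<phi> n j (p k $ l) = of_bool (k = n \<and> l = j)"
    using coordinate_functionals by blast
  interpret coordinate_system N p M \<phi>
    by (intro coordinate_system.intro coordinate_system_axioms.intro recurrent_system_axioms \<phi>)
  show ?case
    using positive_definite_L orthonormal_L[OF w p_dim] recurrent_entries_form_basis[OF p_dim] by blast
qed

end
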